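(* Let $X$ be a $\mu$-symmetric Hunt process on $E$ with semigroup $\{p_t\}_{t>0}$. Assume that $X$ satisfies the following three conditions: I. (Semigroup strong Feller) for any $t>0$, $p_t(\mathcal{B}_b(E))\subset C_b(E)$; II. (Tightness property) $\lim_{x\to\partial}R_1\mathbf{1}_E(x)=0$; III. (Local $L^\infty$-compactness) for any $t>0$ and any open subset $U\subset E$ with $\mu(U)<\infty$, $p_t^U$ is a compact operator on $L^\infty(U,\mu)$. Then, for any $t>0$, $p_t$ is a compact operator on $L^1(E,\mu)$.
   Context: $E$ is a locally compact separable metric space, $\mu$ is a positive Radon measure on $E$ with full topological support, and $E_\partial=E\cup\{\partial\}$ is the one-point compactification of $E$; functions $u$ on $E$ are extended to $E_\partial$ by $u(\partial)=0$. $X=(\{X_t\}_{t\ge0},\{P_x\}_{x\in E},\zeta)$ is a $\mu$-symmetric Hunt process on $E$ with life time $\zeta$; $E_x$ is expectation under $P_x$. $\mathcal{B}_b(E)$ is the space of bounded Borel measurable functions on $E$, $C_b(E)$ the space of bounded continuous functions. For $f\in\mathcal{B}_b(E)$, $p_tf(x)=E_x[f(X_t)]=E_x[f(X_t):t<\zeta]$ and $R_\alpha f(x)=E_x[\int_0^\zeta e^{-\alpha t}f(X_t)\,dt]$. By symmetry and the Markov property, $p_t$ and $R_\alpha$ extend canonically to $L^p(E,\mu)$, $1\le p\le\infty$ (same notation). For an open set $U\subset E$, $\tau_U=\inf\{t>0\mid X_t\notin U\}$ ($\inf\emptyset=\infty$), and $p_t^Uf(x)=E_x[f(X_t):t<\tau_U]$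 is the semigroup of the part process of $X$ on $U$, which is symmetric with respect to $\mu|_U$ and likewise extends to $L^p(U,\mu)$, $1\le p\le\infty$. "$\lim_{x\to\partial}g(x)=0$" means: for every $\varepsilon>0$ there is a compact $K\subset E$ with $|g|<\varepsilon$ on $E\setminus K$. *)

theory Defs
  imports "HOL-Probability.Probability"
begin

section \<open>One-point compactification\<close>

text \<open>The points of the compactification are \<open>Some x\<close>; the added point is \<open>None\<close>.  If
  the original space is already compact, the added point is isolated.\<close>

instantiation option :: (topological_space) topological_space
begin

definition open_option :: "'a option set \<Rightarrow> bool" where
  "open_option S \<longleftrightarrow> openin (Alexandroff_compactification euclidean) S"

instance
proof
  show "open (UNIV :: 'a option set)"
    using openin_topspace[of "Alexandroff_compactification (euclidean :: 'a topology)"]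
    by (simp add: open_option_def topspace_Alexandroff_compactification notin_range_Some UNIV_option_conv)
qed (auto simp: open_option_def)

end

definition extend_zero :: "('a \<Rightarrow> 'b::zero) \<Rightarrow> 'a option \<Rightarrow> 'b" where
  "extend_zero u z = (case z of Some x \<Rightarrow> u x | None \<Rightarrow> 0)"

definition vanishes_at_cemetery :: "('a::topological_space \<Rightarrow> real) \<Rightarrow> bool" where
  "vanishes_at_cemetery g \<longleftrightarrow> (\<forall>\<epsilon>>0. \<exists>K. compact K \<and> (\<forall>x. x \<notin> K \<longrightarrow> \<bar>g x\<bar> < \<epsilon>))"


section \<open>The reference measure\<close>

definition radon_measure :: "'a::topological_space measure \<Rightarrow> bool" where
  "radon_measure \<mu> \<longleftrightarrow>
     sets \<mu> = sets borel \<and>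
     (\<forall>K. compact K \<longrightarrow> emeasure \<mu> K < \<infinity>) \<and>
     (\<forall>B\<in>sets borel. emeasure \<mu> B = (SUP K\<in>{K. compact K \<and> K \<subseteq> B \<and> K \<in> sets borel}. emeasure \<mu> K))"

definition full_support :: "'a::topological_space measure \<Rightarrow> bool" where
  "full_support \<mu> \<longleftrightarrow> (\<forall>U. open U \<longrightarrow> U \<noteq> {} \<longrightarrow> 0 < emeasure \<mu> U)"


section \<open>Hunt processes\<close>

definition lifetime :: "(ennreal \<Rightarrow> 'w \<Rightarrow> 'a option) \<Rightarrow> 'w \<Rightarrow> ennreal" where
  "lifetime X \<omega> = Inf {t. X t \<omega> = None}"

text \<open>Time runs through \<open>[0, \<infinity>]\<close>, so that \<open>X\<close> can be evaluated at every stopping time.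
  Of \<open>M\<close> only the underlying measurable space matters.  The Markov property is the case of
  constant stopping times of the strong Markov property.  The latter and quasi-left-continuity
  are required for the laws \<open>P x\<close> only; for general initial distributions they follow
  by integration.\<close>

locale hunt_process =
  fixes M :: "'w measure"
    and F :: "ennreal \<Rightarrow> 'w measure"
    and X :: "ennreal \<Rightarrow> 'w \<Rightarrow> 'a::topological_space option"
    and \<theta> :: "ennreal \<Rightarrow> 'w \<Rightarrow> 'w"
    and P :: "'a option \<Rightarrow> 'w measure"
  assumes prob_space_P: "\<And>x. prob_space (P x)"
    and sets_P: "\<And>x. sets (P x) = sets M"
    and filtration_F: "filtration (space M) F"
    and subalgebra_F: "\<And>t. subalgebra M (F t)"
    and right_continuous_F: "\<And>t. t < \<infinity> \<Longrightarrow> sets (F t) = (\<Inter>s\<in>{t<..}. sets (F s))"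
    and adapted: "\<And>t. X t \<in> F t \<rightarrow>\<^sub>M borel"
    and measurable_transition: "\<And>t B. B \<in> sets borel \<Longrightarrow>
          (\<lambda>x. measure (P x) {\<omega>\<in>space M. X t \<omega> \<in> B}) \<in> borel_measurable borel"
    and normal: "\<And>x. AE \<omega> in P x. X 0 \<omega> = x"
    and cemetery_trap: "\<And>t. AE \<omega> in P None. X t \<omega> = None"
    and X_infinity: "\<And>\<omega>. \<omega> \<in> space M \<Longrightarrow> X \<infinity> \<omega> = None"
    and X_after_lifetime: "\<And>\<omega> t. \<omega> \<in> space M \<Longrightarrow> lifetime X \<omega> \<le> t \<Longrightarrow> X t \<omega> = None"
    and shift_space: "\<And>t \<omega>. t < \<infinity> \<Longrightarrow> \<omega> \<in> space M \<Longrightarrow> \<theta> t \<omega> \<in> space M"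
    and shift: "\<And>s t \<omega>. t < \<infinity> \<Longrightarrow> \<omega> \<in> space M \<Longrightarrow> X s (\<theta> t \<omega>) = X (s + t) \<omega>"
    and right_continuous_paths: "\<And>\<omega> t. \<omega> \<in> space M \<Longrightarrow> t < \<infinity> \<Longrightarrow>
          ((\<lambda>s. X s \<omega>) \<longlongrightarrow> X t \<omega>) (at_right t)"
    and left_limits: "\<And>\<omega> t. \<omega> \<in> space M \<Longrightarrow> 0 < t \<Longrightarrow> t < \<infinity> \<Longrightarrow>
          \<exists>l. ((\<lambda>s. X s \<omega>) \<longlongrightarrow> l) (at_left t)"
    and strong_markov: "\<And>\<sigma> s B x. stopping_time F \<sigma> \<Longrightarrow> B \<in> sets borel \<Longrightarrow>
          AE \<omega> in P x.
            real_cond_exp (P x) (filtration.pre_sigma (space M) F \<sigma>)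
              (indicator {\<omega>'\<in>space M. X (\<sigma> \<omega>' + s) \<omega>' \<in> B}) \<omega>
            = measure (P (X (\<sigma> \<omega>) \<omega>)) {\<omega>'\<in>space M. X s \<omega>' \<in> B}"
    and quasi_left_continuous: "\<And>\<sigma> x. (\<And>n::nat. stopping_time F (\<sigma> n)) \<Longrightarrow>
          (\<And>n \<omega>. \<omega> \<in> space M \<Longrightarrow> \<sigma> n \<omega> \<le> \<sigma> (Suc n) \<omega>) \<Longrightarrow>
          AE \<omega> in P x. (SUP n. \<sigma> n \<omega>) < \<infinity> \<longrightarrow>
            (\<lambda>n. X (\<sigma> n \<omega>) \<omega>) \<longlonglongrightarrow> X (SUP n. \<sigma> n \<omega>) \<omega>"

definition symmetric_process ::
  "'a::topological_space measure \<Rightarrow> (ennreal \<Rightarrow> 'w \<Rightarrow> 'a option) \<Rightarrow> ('a option \<Rightarrow> 'w measure) \<Rightarrow> bool"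
where
  "symmetric_process \<mu> X P \<longleftrightarrow>
     (\<forall>t::real. \<forall>f\<in>borel_measurable borel. \<forall>g\<in>borel_measurable borel. 0 < t \<longrightarrow>
        (\<integral>\<^sup>+x. f x * (\<integral>\<^sup>+\<omega>. extend_zero g (X (ennreal t) \<omega>) \<partial>P (Some x)) \<partial>\<mu>)
      = (\<integral>\<^sup>+x. (\<integral>\<^sup>+\<omega>. extend_zero f (X (ennreal t) \<omega>) \<partial>P (Some x)) * g x \<partial>\<mu>))"


section \<open>Semigroup, resolvent and part process\<close>

text \<open>The three operators are given by their probabilistic formulas on all functions.  If
  \<open>f\<close> is only in some \<open>L\<^sup>p\<close>, then by symmetry the integral converges for almost every
  \<open>x\<close> and its class does not depend on the representative \<open>f\<close>; the formula is then the
  canonical extension to \<open>L\<^sup>p\<close>.  On the exceptional null set the Bochner integral is 0.\<close>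

definition trans_op ::
  "(ennreal \<Rightarrow> 'w \<Rightarrow> 'a option) \<Rightarrow> ('a option \<Rightarrow> 'w measure) \<Rightarrow> real \<Rightarrow> ('a \<Rightarrow> real) \<Rightarrow> 'a \<Rightarrow> real"
where
  "trans_op X P t f x = (\<integral>\<omega>. extend_zero f (X (ennreal t) \<omega>) \<partial>P (Some x))"

definition resolvent_op ::
  "(ennreal \<Rightarrow> 'w \<Rightarrow> 'a option) \<Rightarrow> ('a option \<Rightarrow> 'w measure) \<Rightarrow> real \<Rightarrow> ('a \<Rightarrow> real) \<Rightarrow> 'a \<Rightarrow> real"
where
  "resolvent_op X P \<alpha> f x =
     (\<integral>\<omega>. (LINT t:{t. 0 \<le> t \<and> ennreal t < lifetime X \<omega>}|lborel.
              exp (- \<alpha> * t) * extend_zero f (X (ennreal t) \<omega>)) \<partial>P (Some x))"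

definition exit_time :: "(ennreal \<Rightarrow> 'w \<Rightarrow> 'a option) \<Rightarrow> 'a set \<Rightarrow> 'w \<Rightarrow> ennreal" where
  "exit_time X U \<omega> = Inf {t. 0 < t \<and> X t \<omega> \<notin> Some ` U}"

text \<open>The event \<open>t < \<tau>\<^sub>U\<close> need only be measurable up to null sets, hence the completion.\<close>

definition part_op ::
  "(ennreal \<Rightarrow> 'w \<Rightarrow> 'a option) \<Rightarrow> ('a option \<Rightarrow> 'w measure) \<Rightarrow> 'a set \<Rightarrow> real \<Rightarrow> ('a \<Rightarrow> real) \<Rightarrow> 'a \<Rightarrow> real"
where
  "part_op X P U t f x =
     (\<integral>\<omega>. indicator {\<omega>. ennreal t < exit_time X U \<omega>} \<omega> * extend_zero f (X (ennreal t) \<omega>)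
        \<partial>completion (P (Some x)))"


section \<open>Compact operators on Lebesgue spaces\<close>

definition L1_norm :: "'a measure \<Rightarrow> ('a \<Rightarrow> real) \<Rightarrow> ennreal" where
  "L1_norm M f = (\<integral>\<^sup>+x. ennreal \<bar>f x\<bar> \<partial>M)"

definition Linf_norm :: "'a measure \<Rightarrow> ('a \<Rightarrow> real) \<Rightarrow> ennreal" where
  "Linf_norm M f = esssup M (\<lambda>x. ennreal \<bar>f x\<bar>)"

definition Lspace :: "('a measure \<Rightarrow> ('a \<Rightarrow> real) \<Rightarrow> ennreal) \<Rightarrow> 'a measure \<Rightarrow> ('a \<Rightarrow> real) set" where
  "Lspace N M = {f \<in> borel_measurable M. N M f < \<infinity>}"

text \<open>Elements of the Lebesgue spaces are represented by functions, so linearity holds almost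
  everywhere.  Independence of the representative follows from the two other conditions:
  if \<open>f\<close> is null, so are all \<open>n \<cdot> f\<close>, and \<open>n \<cdot> T f\<close> has a convergent
  subsequence only if \<open>T f\<close> is null.\<close>

definition compact_operator ::
  "('a measure \<Rightarrow> ('a \<Rightarrow> real) \<Rightarrow> ennreal) \<Rightarrow> 'a measure \<Rightarrow> (('a \<Rightarrow> real) \<Rightarrow> 'a \<Rightarrow> real) \<Rightarrow> bool"
where
  "compact_operator N M T \<longleftrightarrow>
     (\<forall>f\<in>Lspace N M. T f \<in> Lspace N M) \<and>
     (\<forall>f\<in>Lspace N M. \<forall>g\<in>Lspace N M. \<forall>a b.
        AE x in M. T (\<lambda>y. a * f y + b * g y) x = a * T f x + b * T g x) \<and>
     (\<forall>f::nat \<Rightarrow> 'a \<Rightarrow> real. (\<forall>n. f n \<in> Lspace N M \<and> N M (f n) \<le> 1) \<longrightarrow>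
        (\<exists>g\<in>Lspace N M. \<exists>r::nat \<Rightarrow> nat. strict_mono r \<and>
           (\<lambda>n. N M (\<lambda>x. T (f (r n)) x - g x)) \<longlonglongrightarrow> 0))"

end

theory Submission
  imports Defs
begin

text \<open>By symmetry, \<open>p\<^sub>t\<close> on \<open>L\<^sup>1\<close> is dual to \<open>p\<^sub>t\<close> on \<open>L\<^sup>\<infinity>\<close>, and Schauder's argument carries compactness
  over from \<open>L\<^sup>\<infinity>\<close> to \<open>L\<^sup>1\<close>.  The distance of \<open>p\<^sub>t f\<close> and \<open>p\<^sub>t h\<close> in \<open>L\<^sup>1\<close> is attained by pairing their
  difference with two indicator functions, so finite nets in \<open>L\<^sup>\<infinity>\<close> for the functions \<open>p\<^sub>t 1\<^sub>A\<close>, with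
  \<open>A\<close> a Borel set, suffice (\<open>L1_compact_if_dual_precompact\<close>).  The restriction to indicator functions
  turns the remaining estimates into estimates of probabilities of events.

  The nets come from the part process.  Tightness gives a compact set \<open>K\<close> such that the probability
  \<open>p\<^sub>t 1\<close> of surviving for time \<open>t\<close> is at most \<open>\<epsilon>\<close> outside of \<open>K\<close>, because \<open>R\<^sub>1 1\<close> dominates a multiple of
  \<open>p\<^sub>t 1\<close> (\<open>survival_le_resolvent\<close>).  Let \<open>U\<close> be a relatively compact open neighbourhood of \<open>K\<close>.  A path
  that leaves \<open>U\<close> by time \<open>t\<close> and is alive at time \<open>2t\<close> survives for another time \<open>t\<close> after an exit at a
  position outside of \<open>K\<close>; by the strong Markov property this has probability at most \<open>\<epsilon>\<close>
  (\<open>exit_and_survive_le\<close>).  So \<open>p\<^sub>2\<^sub>t 1\<^sub>A\<close> differs on \<open>U\<close> by at most \<open>\<epsilon>\<close> from \<open>p\<^sub>t\<^sup>U (p\<^sub>t 1\<^sub>A)\<close>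
  (\<open>trans_op_double_time_near_part_op\<close>), and it is at most \<open>\<epsilon>\<close> outside of \<open>U\<close>.  Since \<open>U\<close> has finite
  measure, \<open>p\<^sub>t\<^sup>U\<close> is compact on \<open>L\<^sup>\<infinity>(U)\<close>, and every sequence of Borel sets contains two whose functions
  \<open>p\<^sub>2\<^sub>t 1\<^sub>A\<close> are within \<open>4\<epsilon>\<close> of each other (\<open>finite_net_of_trans_op_indicators\<close>).

  The exit time from \<open>U\<close> is not at once a stopping time, since paths may touch the closed complement
  without entering its interior.  It is approximated from below by the exit times from compact
  subsets of \<open>U\<close>, and quasi-left-continuity shows that the approximation is exact almost surely
  (\<open>exit_time_eq_SUP_hitting_time\<close>).\<close>

section \<open>Compactness in the space of integrable functions by duality\<close>

text \<open>An infinite sequence without close pairs could be chosen greedily if no finite set were a net.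
  Only close pairs are asked for, so nothing about the relation \<open>R\<close> has to be known: it need not come
  from a metric, and closeness almost everywhere is allowed.\<close>

lemma finite_net_if_close_pairs:
  assumes close: "\<And>f :: nat \<Rightarrow> 'b. range f \<subseteq> S \<Longrightarrow> \<exists>m n. m < n \<and> R (f m) (f n)"
  shows "\<exists>T. finite T \<and> T \<subseteq> S \<and> (\<forall>x\<in>S. \<exists>y\<in>T. R y x)"
proof (rule ccontr)
  assume no_net: "\<not> ?thesis"
  have "\<exists>f :: nat \<Rightarrow> 'b. \<forall>n. f n \<in> S \<and> (\<forall>m<n. \<not> R (f m) (f n))"
  proof (rule dependent_wellorder_choice)
    fix n :: nat and f :: "nat \<Rightarrow> 'b"
    assume "\<And>m. m < n \<Longrightarrow> f m \<in> S \<and> (\<forall>i<m. \<not> R (f i) (f m))"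
    then have "finite (f ` {..<n})" "f ` {..<n} \<subseteq> S"
      by auto
    with no_net show "\<exists>y. y \<in> S \<and> (\<forall>m<n. \<not> R (f m) y)"
      by (metis imageI lessThan_iff)
  qed simp
  then show False
    using close by (metis image_subset_iff)
qed

text \<open>A Cauchy sequence has an almost everywhere convergent subsequence, and Fatou's lemma turns the
  Cauchy bound into a bound on the distance to the limit.\<close>

lemma L1_complete:
  fixes u :: "nat \<Rightarrow> 'a \<Rightarrow> real"
  assumes int [measurable]: "\<And>n. integrable M (u n)"
    and Cauchy: "\<And>e. e > 0 \<Longrightarrow> \<exists>N. \<forall>i\<ge>N. \<forall>j\<ge>N. (LINT x|M. \<bar>u i x - u j x\<bar>) < e"
  obtains g where "integrable M g" "(\<lambda>n. LINT x|M. \<bar>u n x - g x\<bar>) \<longlonglongrightarrow> 0"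
proof -
  obtain r where r: "strict_mono r" and AE_Cauchy: "AE x in M. Cauchy (\<lambda>i. u (r i) x)"
    using cauchy_L1_AE_cauchy_subseq[of M u] int Cauchy by auto
  define g where "g x = lim (\<lambda>i. u (r i) x)" for x
  have g_meas [measurable]: "g \<in> borel_measurable M"
    unfolding g_def by measurable
  have lim_g: "AE x in M. (\<lambda>i. u (r i) x) \<longlonglongrightarrow> g x"
    using AE_Cauchy by eventually_elim (simp add: g_def Cauchy_convergent_iff convergent_LIMSEQ_iff)
  have Fatou: "(\<integral>\<^sup>+x. ennreal \<bar>u n x - g x\<bar> \<partial>M) \<le> ennreal e"
    if "\<forall>i\<ge>N. \<forall>j\<ge>N. (LINT x|M. \<bar>u i x - u j x\<bar>) < e" "n \<ge> N" for n N e
  proof -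
    have "(\<integral>\<^sup>+x. ennreal \<bar>u n x - g x\<bar> \<partial>M) = (\<integral>\<^sup>+x. liminf (\<lambda>i. ennreal \<bar>u n x - u (r i) x\<bar>) \<partial>M)"
    proof (rule nn_integral_cong_AE, use lim_g in eventually_elim)
      fix x assume "(\<lambda>i. u (r i) x) \<longlonglongrightarrow> g x"
      then have "(\<lambda>i. ennreal \<bar>u n x - u (r i) x\<bar>) \<longlonglongrightarrow> ennreal \<bar>u n x - g x\<bar>"
        by (intro tendsto_intros)
      then show "ennreal \<bar>u n x - g x\<bar> = liminf (\<lambda>i. ennreal \<bar>u n x - u (r i) x\<bar>)"
        by (rule lim_imp_Liminf[OF sequentially_bot, symmetric])
    qed
    also have "\<dots> \<le> liminf (\<lambda>i. \<integral>\<^sup>+x. ennreal \<bar>u n x - u (r i) x\<bar> \<partial>M)"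
      by (rule nn_integral_liminf) measurable
    also have "\<dots> \<le> liminf (\<lambda>i. ennreal e)"
    proof (rule Liminf_mono)
      show "\<forall>\<^sub>F i in sequentially. (\<integral>\<^sup>+x. ennreal \<bar>u n x - u (r i) x\<bar> \<partial>M) \<le> ennreal e"
      proof (rule eventually_sequentiallyI)
        fix i assume "i \<ge> N"
        then have "r i \<ge> N" using r seq_suble order_trans by blast
        then have "(LINT x|M. \<bar>u n x - u (r i) x\<bar>) < e" using that by blast
        then show "(\<integral>\<^sup>+x. ennreal \<bar>u n x - u (r i) x\<bar> \<partial>M) \<le> ennreal e"
          using int by (subst nn_integral_eq_integral) (auto intro!: ennreal_leI integrable_abs)
      qed
    qed
    finally show ?thesis by (simp add: Liminf_const)
  qed
  obtain N where N: "\<forall>i\<ge>N. \<forall>j\<ge>N. (LINT x|M. \<bar>u i x - u j x\<bar>) < 1"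
    using Cauchy[of 1] by auto
  have "integrable M (\<lambda>x. u N x - g x)"
    using Fatou[OF N order_refl, THEN le_less_trans, OF ennreal_less_top]
    by (intro integrableI_bounded) auto
  with int have "integrable M (\<lambda>x. u N x - (u N x - g x))"
    by (rule Bochner_Integration.integrable_diff)
  moreover have "(\<lambda>x. u N x - (u N x - g x)) = g" by auto
  ultimately have int_g: "integrable M g" by metis
  have "(\<lambda>n. LINT x|M. \<bar>u n x - g x\<bar>) \<longlonglongrightarrow> 0"
  proof (rule LIMSEQ_I)
    fix e :: real assume "0 < e"
    then obtain N where N: "\<forall>i\<ge>N. \<forall>j\<ge>N. (LINT x|M. \<bar>u i x - u j x\<bar>) < e / 2"
      using Cauchy[of "e / 2"] by auto
    have "(LINT x|M. \<bar>u n x - g x\<bar>) \<le> e / 2" if "n \<ge> N" for n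
    proof -
      have "integrable M (\<lambda>x. \<bar>u n x - g x\<bar>)" using int int_g by simp
      from nn_integral_eq_integral[OF this] Fatou[OF N that] \<open>0 < e\<close> show ?thesis by simp
    qed
    moreover have "0 \<le> (LINT x|M. \<bar>u n x - g x\<bar>)" for n by simp
    ultimately show "\<exists>no. \<forall>n\<ge>no. norm ((LINT x|M. \<bar>u n x - g x\<bar>) - 0) < e"
      using \<open>0 < e\<close> by (intro exI[of _ N]) (smt (verit) field_sum_of_halves real_norm_def)
  qed
  with int_g show ?thesis by (rule that)
qed

text \<open>This is sequential compactness of a countable product of compact intervals.\<close>

lemma diagonal_subsequence:
  fixes a :: "nat \<Rightarrow> 'j::countable \<Rightarrow> real"
  assumes "\<And>n j. \<bar>a n j\<bar> \<le> C"
  obtains r where "strict_mono r" "\<And>j. convergent (\<lambda>n. a (r n) j)"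
proof -
  have "compactin (product_topology (\<lambda>j::'j. euclidean) UNIV) (PiE UNIV (\<lambda>j. {-C..C}))"
    unfolding compactin_PiE by simp
  then have "seq_compact (PiE UNIV (\<lambda>j::'j. {-C..C}))"
    by (intro compact_imp_seq_compact) (simp add: euclidean_product_topology)
  moreover have "\<forall>n. a n \<in> PiE UNIV (\<lambda>j. {-C..C})"
    using assms by (auto simp: abs_le_iff minus_le_iff)
  ultimately obtain l r where "strict_mono r" and lim: "(a \<circ> r) \<longlonglongrightarrow> l"
    unfolding seq_compact_def by blast
  moreover have "(\<lambda>n. a (r n) j) \<longlonglongrightarrow> l j" for j
    using continuous_on_tendsto_compose[OF continuous_on_product_coordinates[of j] lim] by simp
  ultimately show ?thesis using that convergentI by metis
qed

text \<open>The distance of \<open>u\<close> and \<open>v\<close> in \<open>L\<^sup>1\<close> is attained by pairing \<open>u - v\<close> with the indicators of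
  \<open>{u > v}\<close> and \<open>{u < v}\<close>.  Duality moves the pairing to \<open>f - h\<close>, where the test functions \<open>S A\<close>
  can be replaced by members of the net at the cost of \<open>e\<close> for each of \<open>f\<close> and \<open>h\<close>.\<close>

lemma L1_distance_le_dual_net:
  fixes u v :: "'a \<Rightarrow> real"
  assumes int [measurable]: "integrable M f" "integrable M h" "integrable M u" "integrable M v"
    and u: "\<And>A. A \<in> sets M \<Longrightarrow> (LINT x|M. u x * indicator A x) = (LINT x|M. f x * S A x)"
    and v: "\<And>A. A \<in> sets M \<Longrightarrow> (LINT x|M. v x * indicator A x) = (LINT x|M. h x * S A x)"
    and S_meas [measurable]: "\<And>A. A \<in> sets M \<Longrightarrow> S A \<in> borel_measurable M"
    and S_le: "\<And>A x. A \<in> sets M \<Longrightarrow> \<bar>S A x\<bar> \<le> 1"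
    and T: "T \<subseteq> sets M" "\<And>A. A \<in> sets M \<Longrightarrow> \<exists>B\<in>T. AE x in M. \<bar>S B x - S A x\<bar> \<le> e"
    and \<delta>: "\<And>B. B \<in> T \<Longrightarrow> \<bar>(LINT x|M. f x * S B x) - (LINT x|M. h x * S B x)\<bar> \<le> \<delta>"
    and norms: "(LINT x|M. \<bar>f x\<bar>) \<le> 1" "(LINT x|M. \<bar>h x\<bar>) \<le> 1"
    and "0 \<le> e"
  shows "(LINT x|M. \<bar>u x - v x\<bar>) \<le> 2 * \<delta> + 4 * e"
proof -
  have int_S: "integrable M (\<lambda>x. k x * S A x)" if "integrable M k" "A \<in> sets M" for k A
  proof (rule Bochner_Integration.integrable_bound[OF that(1)])
    show "(\<lambda>x. k x * S A x) \<in> borel_measurable M" using that by measurable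
    show "AE x in M. norm (k x * S A x) \<le> norm (k x)"
      using S_le[OF that(2)] by (auto simp: abs_mult intro!: AE_I2 mult_left_le)
  qed
  have pairing: "\<bar>(LINT x|M. f x * S A x) - (LINT x|M. h x * S A x)\<bar> \<le> \<delta> + 2 * e" if A: "A \<in> sets M" for A
  proof -
    obtain B where B: "B \<in> T" "AE x in M. \<bar>S B x - S A x\<bar> \<le> e" using T(2)[OF A] by blast
    then have [measurable]: "B \<in> sets M" using T by auto
    have near: "\<bar>(LINT x|M. k x * S A x) - (LINT x|M. k x * S B x)\<bar> \<le> e"
      if k [measurable]: "integrable M k" and "(LINT x|M. \<bar>k x\<bar>) \<le> 1" for k
    proof -
      have "\<bar>(LINT x|M. k x * S A x) - (LINT x|M. k x * S B x)\<bar> = \<bar>LINT x|M. k x * S A x - k x * S B x\<bar>"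
        using int_S k A by simp
      also have "\<dots> \<le> (LINT x|M. \<bar>k x * S A x - k x * S B x\<bar>)"
        by (rule integral_abs_bound)
      also have "\<dots> \<le> (LINT x|M. e * \<bar>k x\<bar>)"
      proof (rule integral_mono_AE)
        show "AE x in M. \<bar>k x * S A x - k x * S B x\<bar> \<le> e * \<bar>k x\<bar>"
          using B(2)
        proof eventually_elim
          fix x assume "\<bar>S B x - S A x\<bar> \<le> e"
          then have "\<bar>k x\<bar> * \<bar>S A x - S B x\<bar> \<le> \<bar>k x\<bar> * e" by (intro mult_left_mono) auto
          then show "\<bar>k x * S A x - k x * S B x\<bar> \<le> e * \<bar>k x\<bar>"
            by (simp add: abs_mult[symmetric] right_diff_distrib mult.commute)
        qed
      qed (use int_S k A in auto)
      also have "\<dots> \<le> e" using that(2) \<open>0 \<le> e\<close> by (simp add: mult_left_le)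
      finally show ?thesis .
    qed
    from near[OF int(1) norms(1)] near[OF int(2) norms(2)] \<delta>[OF B(1)] show ?thesis by linarith
  qed
  define A where "A = {x \<in> space M. u x - v x > 0}"
  define B where "B = {x \<in> space M. u x - v x < 0}"
  have [measurable]: "A \<in> sets M" "B \<in> sets M" unfolding A_def B_def by measurable
  have int_ind: "integrable M (\<lambda>x. k x * indicator D x)" if "integrable M k" "D \<in> sets M" for k :: "'a \<Rightarrow> real" and D
    using that by (rule integrable_real_mult_indicator[rotated])
  have "(LINT x|M. \<bar>u x - v x\<bar>)
      = (LINT x|M. (u x * indicator A x - v x * indicator A x) - (u x * indicator B x - v x * indicator B x))"
    by (rule Bochner_Integration.integral_cong) (auto simp: A_def B_def indicator_def)
  also have "\<dots> = ((LINT x|M. f x * S A x) - (LINT x|M. h x * S A x))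
      - ((LINT x|M. f x * S B x) - (LINT x|M. h x * S B x))"
    using int_ind int by (simp add: u v)
  also have "\<dots> \<le> 2 * \<delta> + 4 * e"
    using pairing[of A] pairing[of B] by simp
  finally show ?thesis .
qed

text \<open>Schauder's theorem on adjoints, in the direction from \<open>L\<^sup>\<infinity>\<close> to \<open>L\<^sup>1\<close>.  The map \<open>S\<close> is the dual
  operator on indicator functions, and \<open>u n\<close> is the image of \<open>f n\<close>.  All pairings with the members of
  countably many finite nets converge along one diagonal subsequence, which is then Cauchy.\<close>

lemma L1_compact_if_dual_precompact:
  fixes f :: "nat \<Rightarrow> 'a \<Rightarrow> real"
  assumes f: "\<And>n. integrable M (f n)" "\<And>n. (LINT x|M. \<bar>f n x\<bar>) \<le> 1"
    and u: "\<And>n. integrable M (u n)"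
    and dual: "\<And>n A. A \<in> sets M \<Longrightarrow> (LINT x|M. u n x * indicator A x) = (LINT x|M. f n x * S A x)"
    and S_meas [measurable]: "\<And>A. A \<in> sets M \<Longrightarrow> S A \<in> borel_measurable M"
    and S_le: "\<And>A x. A \<in> sets M \<Longrightarrow> \<bar>S A x\<bar> \<le> 1"
    and net: "\<And>e. e > 0 \<Longrightarrow> \<exists>T. finite T \<and> T \<subseteq> sets M \<and> (\<forall>A\<in>sets M. \<exists>B\<in>T. AE x in M. \<bar>S B x - S A x\<bar> \<le> e)"
  obtains g r where "integrable M g" "strict_mono r" "(\<lambda>n. LINT x|M. \<bar>u (r n) x - g x\<bar>) \<longlonglongrightarrow> 0"
proof -
  have "\<forall>k. \<exists>T. finite T \<and> T \<subseteq> sets M \<and> (\<forall>A\<in>sets M. \<exists>B\<in>T. AE x in M. \<bar>S B x - S A x\<bar> \<le> 1 / real (Suc k))"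
    using net by simp
  then obtain T where T: "\<And>k. finite (T k)" "\<And>k. T k \<subseteq> sets M"
    "\<And>k A. A \<in> sets M \<Longrightarrow> \<exists>B\<in>T k. AE x in M. \<bar>S B x - S A x\<bar> \<le> 1 / real (Suc k)"
    by metis
  \<comment> \<open>The empty set only ensures that the enumeration \<open>from_nat_into D\<close> stays inside \<open>D\<close>.\<close>
  define D where "D = insert {} (\<Union>k. T k)"
  have D: "countable D" "D \<noteq> {}" "D \<subseteq> sets M"
    using T(1,2) by (auto simp: D_def intro: countable_finite)
  define a where "a n j = (LINT x|M. f n x * S (from_nat_into D j) x)" for n j
  have "\<bar>a n j\<bar> \<le> 1" for n j
  proof -
    have B: "from_nat_into D j \<in> sets M" using from_nat_into[OF D(2)] D(3) by (rule subsetD[rotated])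
    have "\<bar>a n j\<bar> \<le> (LINT x|M. \<bar>f n x * S (from_nat_into D j) x\<bar>)"
      unfolding a_def by (rule integral_abs_bound)
    also have "\<dots> \<le> (LINT x|M. \<bar>f n x\<bar>)"
    proof (rule integral_mono')
      show "\<bar>f n x * S (from_nat_into D j) x\<bar> \<le> \<bar>f n x\<bar>" for x
        using S_le[OF B, of x] by (simp add: abs_mult mult_left_le)
    qed (use f in auto)
    finally show ?thesis using f(2)[of n] by linarith
  qed
  then obtain r where r: "strict_mono r" and conv: "\<And>j. convergent (\<lambda>n. a (r n) j)"
    using diagonal_subsequence by blast
  have Cauchy: "\<exists>N. \<forall>i\<ge>N. \<forall>j\<ge>N. (LINT x|M. \<bar>u (r i) x - u (r j) x\<bar>) < e" if "e > 0" for e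
  proof -
    \<comment> \<open>The final bound is \<open>2 * (e / 4) + 4 / Suc k\<close>.\<close>
    obtain k where k: "1 / real (Suc k) < e / 8"
      using \<open>e > 0\<close> reals_Archimedean[of "e / 8"] by (auto simp: inverse_eq_divide)
    have "\<forall>B\<in>T k. \<exists>N. \<forall>i\<ge>N. \<forall>j\<ge>N. \<bar>(LINT x|M. f (r i) x * S B x) - (LINT x|M. f (r j) x * S B x)\<bar> < e / 4"
    proof
      fix B assume "B \<in> T k"
      then have "B \<in> D" by (auto simp: D_def)
      then obtain l where "B = from_nat_into D l"
        using from_nat_into_surj[OF D(1)] by metis
      moreover have "Cauchy (\<lambda>n. a (r n) l)" using conv by (rule convergent_Cauchy)
      ultimately show "\<exists>N. \<forall>i\<ge>N. \<forall>j\<ge>N. \<bar>(LINT x|M. f (r i) x * S B x) - (LINT x|M. f (r j) x * S B x)\<bar> < e / 4"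
        using metric_CauchyD[of "\<lambda>n. a (r n) l" "e / 4"] \<open>e > 0\<close> unfolding a_def dist_real_def by simp
    qed
    then obtain N where N: "\<And>B i j. B \<in> T k \<Longrightarrow> i \<ge> N B \<Longrightarrow> j \<ge> N B
        \<Longrightarrow> \<bar>(LINT x|M. f (r i) x * S B x) - (LINT x|M. f (r j) x * S B x)\<bar> < e / 4"
      by metis
    have "(LINT x|M. \<bar>u (r i) x - u (r j) x\<bar>) < e" if "i \<ge> Max (N ` T k)" "j \<ge> Max (N ` T k)" for i j
    proof -
      have "(LINT x|M. \<bar>u (r i) x - u (r j) x\<bar>) \<le> 2 * (e / 4) + 4 * (1 / real (Suc k))"
      proof (rule L1_distance_le_dual_net[where f = "f (r i)" and h = "f (r j)" and S = S and T = "T k"])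
        fix B assume B: "B \<in> T k"
        then have "N B \<le> Max (N ` T k)" using T(1) by simp
        with that N[OF B] show "\<bar>(LINT x|M. f (r i) x * S B x) - (LINT x|M. f (r j) x * S B x)\<bar> \<le> e / 4"
          by (meson less_imp_le order_trans)
      qed (use f u dual S_le T in auto)
      also have "\<dots> < e" using k by simp
      finally show ?thesis .
    qed
    then show ?thesis by blast
  qed
  obtain g where "integrable M g" "(\<lambda>n. LINT x|M. \<bar>u (r n) x - g x\<bar>) \<longlonglongrightarrow> 0"
    using L1_complete[of M "\<lambda>n. u (r n)"] u Cauchy by blast
  with r show ?thesis by (intro that)
qed

section \<open>Topology and Borel sets of the one-point compactification\<close>

lemma open_Some_image: "open V \<Longrightarrow> open (Some ` V)"
  by (auto simp: open_option_def openin_Alexandroff_compactification)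

lemma open_Compl_Some_image:
  assumes "compact C" "closed C"
  shows "open (- Some ` C)"
proof -
  have "z \<in> - Some ` C \<longleftrightarrow> z \<in> insert None (Some ` (UNIV - C))" for z
    by (cases z) auto
  then have "- Some ` C = insert None (Some ` (UNIV - C))" by blast
  then show ?thesis
    using assms by (auto simp: open_option_def openin_Alexandroff_compactification)
qed

lemma measurable_Some_option: "Some \<in> borel \<rightarrow>\<^sub>M borel"
proof (rule borel_measurableI)
  fix S :: "'a option set" assume "open S"
  then consider U where "open U" "S = Some ` U"
    | C where "closed C" "S = insert None (Some ` (UNIV - C))"
    by (auto simp: open_option_def openin_Alexandroff_compactification)
  then have "open (Some -` S)"
  proof cases
    case 1 then show ?thesis by (simp add: inj_vimage_image_eq)
  next
    case 2
    then have "Some -` S = - C" by auto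
    with 2 show ?thesis by (simp add: open_Compl)
  qed
  then show "Some -` S \<inter> space borel \<in> sets borel" by simp
qed

lemma sets_borel_Some_image:
  assumes "B \<in> sets borel"
  shows "Some ` B \<in> sets (borel :: 'a::topological_space option measure)"
  using assms unfolding sets_borel
proof (induction rule: sigma_sets.induct)
  case (Basic a)
  then show ?case by (simp add: open_Some_image sets_borel[symmetric])
next
  case (Compl a)
  have "Some ` (UNIV - a) = range Some - Some ` a" by auto
  moreover have "range (Some :: 'a \<Rightarrow> _) \<in> sets borel" by (simp add: open_Some_image)
  ultimately show ?case using Compl by (simp add: sets_borel[symmetric] sets.Diff)
next
  case (Union a)
  then have "(\<Union>i. Some ` a i) \<in> sets borel" by (intro sets.countable_UN) (auto simp: sets_borel)
  then show ?case by (simp add: image_UN sets_borel)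
qed (simp add: sets_borel[symmetric])

text \<open>The point \<open>None\<close> is closed and \<open>Some\<close> is an open embedding, so only the restriction of \<open>h\<close> to the
  original space matters.\<close>

lemma borel_measurable_option:
  assumes "(\<lambda>x. h (Some x)) \<in> borel \<rightarrow>\<^sub>M N" "h None \<in> space N"
  shows "h \<in> (borel :: 'a::topological_space option measure) \<rightarrow>\<^sub>M N"
proof (rule measurableI)
  fix z :: "'a option" show "h z \<in> space N"
    using assms measurable_space[OF assms(1)] by (cases z) auto
next
  fix S assume "S \<in> sets N"
  have None: "{None :: 'a option} \<in> sets borel"
  proof -
    have "z \<in> {None} \<longleftrightarrow> z \<in> - range (Some :: 'a \<Rightarrow> _)" for z by (cases z) auto
    then have "{None} = - range (Some :: 'a \<Rightarrow> _)" by blast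
    then show ?thesis by (simp add: open_Some_image)
  qed
  have "Some ` ((\<lambda>x. h (Some x)) -` S) \<in> sets borel"
    using measurable_sets[OF assms(1) \<open>S \<in> sets N\<close>] by (intro sets_borel_Some_image) simp
  moreover have "z \<in> h -` S \<longleftrightarrow> z \<in> Some ` ((\<lambda>x. h (Some x)) -` S) \<union> (if h None \<in> S then {None} else {})" for z
    by (cases z) auto
  then have "h -` S = Some ` ((\<lambda>x. h (Some x)) -` S) \<union> (if h None \<in> S then {None} else {})" by blast
  ultimately show "h -` S \<inter> space borel \<in> sets borel" using None by (auto intro: sets.insert_in_sets)
qed

lemma borel_measurable_extend_zero:
  fixes f :: "'a::topological_space \<Rightarrow> 'b::{zero, topological_space}"
  assumes "f \<in> borel_measurable borel"
  shows "extend_zero f \<in> borel_measurable borel"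
  using assms by (intro borel_measurable_option) (simp_all add: extend_zero_def)

lemma extend_zero_Some [simp]: "extend_zero f (Some x) = f x"
  and extend_zero_None [simp]: "extend_zero f None = 0"
  by (simp_all add: extend_zero_def)

text \<open>The sets are the super-level sets of the distance to the complement of \<open>U\<close>.\<close>

lemma compact_exhaustion_of_open:
  fixes U :: "'a::metric_space set"
  assumes U: "open U" "U \<subseteq> L" and "compact L" and K: "compact K" "K \<subseteq> U"
  obtains V C :: "nat \<Rightarrow> 'a set" and N where "\<And>n. open (V n)" "\<And>n. compact (C n)" "\<And>n. V n \<subseteq> C n"
    "incseq V" "incseq C" "\<And>n. C n \<subseteq> U" "U = (\<Union>n. V n)" "K \<subseteq> V N"
proof -
  \<comment> \<open>If \<open>U\<close> is the whole space, the distance to the empty complement would be \<open>0\<close>.\<close>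
  define \<phi> where "\<phi> x = (if U = UNIV then 1 else infdist x (- U))" for x
  have cont: "continuous_on UNIV \<phi>"
    unfolding \<phi>_def by (cases "U = UNIV") (auto intro!: continuous_intros)
  have pos: "x \<in> U \<longleftrightarrow> 0 < \<phi> x" for x
  proof (cases "U = UNIV")
    case False
    have "x \<in> - U \<longleftrightarrow> infdist x (- U) = 0"
      using False U(1) by (intro in_closed_iff_infdist_zero) auto
    then show ?thesis
      using False infdist_nonneg[of x "- U"] by (auto simp: \<phi>_def)
  qed (simp add: \<phi>_def)
  define V where "V n = {x. 1 / real (Suc n) < \<phi> x}" for n
  define C where "C n = {x. 1 / real (Suc n) \<le> \<phi> x}" for n
  have C_U: "C n \<subseteq> U" for n
  proof
    fix x assume "x \<in> C n"
    then have "1 / real (Suc n) \<le> \<phi> x" by (simp add: C_def)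
    moreover have "0 < 1 / real (Suc n)" by simp
    ultimately show "x \<in> U" unfolding pos by linarith
  qed
  have anti: "1 / real (Suc n) \<le> 1 / real (Suc m)" if "m \<le> n" for m n
    using that by (intro divide_left_mono) auto
  have V_open: "open (V n)" for n
    unfolding V_def using cont by (intro open_Collect_less) auto
  have "closed (C n)" for n
    unfolding C_def using cont by (intro closed_Collect_le) auto
  then have C_compact: "compact (C n)" for n
    using C_U[of n] U(2) \<open>compact L\<close> by (metis compact_Int_closed inf.absorb2 order_trans)
  have V_C: "V n \<subseteq> C n" for n by (auto simp: V_def C_def)
  have V_mono: "incseq V"
    unfolding incseq_def V_def using anti by (auto intro: le_less_trans)
  have C_mono: "incseq C"
    unfolding incseq_def C_def using anti by (auto intro: order_trans)
  have "\<exists>n. x \<in> V n" if "0 < \<phi> x" for x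
    using reals_Archimedean[OF that] by (auto simp: V_def inverse_eq_divide)
  then have "U \<subseteq> (\<Union>n. V n)" by (auto simp: pos)
  moreover have "V n \<subseteq> U" for n using V_C C_U by (rule order_trans)
  ultimately have U_eq: "U = (\<Union>n. V n)" by (simp add: UN_least subset_antisym)
  obtain D where D: "finite D" "K \<subseteq> (\<Union>n\<in>D. V n)"
    using compactE_image[OF K(1), of UNIV V] K(2) V_open U_eq by auto
  have "(\<Union>n\<in>D. V n) \<subseteq> V (Max D)"
    using D(1) by (intro UN_least incseqD[OF V_mono] Max_ge)
  with D(2) have "K \<subseteq> V (Max D)" by (rule order_trans)
  with V_open C_compact V_C V_mono C_mono C_U U_eq show thesis by (rule that)
qed

section \<open>Hitting times and the strong Markov property\<close>

definition hitting_time :: "(ennreal \<Rightarrow> 'w \<Rightarrow> 'b) \<Rightarrow> 'b set \<Rightarrow> 'w \<Rightarrow> ennreal" where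
  "hitting_time X G \<omega> = Inf {t. X t \<omega> \<in> G}"

context hunt_process
begin

lemma space_P [simp]: "space (P x) = space M"
  using sets_eq_imp_space_eq[OF sets_P] .

lemma measurable_P_iff: "f \<in> P x \<rightarrow>\<^sub>M N \<longleftrightarrow> f \<in> M \<rightarrow>\<^sub>M N"
  using measurable_cong_sets[OF sets_P refl] by blast

lemma space_F: "space (F t) = space M"
  using filtration_F by (rule filtration.space_F)

lemma sets_F_subset: "sets (F t) \<subseteq> sets M"
  using subalgebra_F[of t] by (simp add: subalgebra_def)

lemma sets_F_mono: "s \<le> t \<Longrightarrow> sets (F s) \<subseteq> sets (F t)"
  using filtration_F by (rule filtration.sets_F_mono)

lemma measurable_X [measurable]: "X t \<in> M \<rightarrow>\<^sub>M borel"
  using adapted[of t] subalgebra_F[of t] measurable_from_subalg by blast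

lemma measurable_X_P [measurable]: "X t \<in> P x \<rightarrow>\<^sub>M borel"
  by (simp add: measurable_P_iff)

lemma lifetime_le_iff:
  assumes "\<omega> \<in> space M"
  shows "lifetime X \<omega> \<le> t \<longleftrightarrow> X t \<omega> = None"
  using X_after_lifetime[OF assms] by (auto simp: lifetime_def intro: Inf_lower)

lemma less_lifetime_iff:
  assumes "\<omega> \<in> space M"
  shows "t < lifetime X \<omega> \<longleftrightarrow> X t \<omega> \<in> range Some"
  using lifetime_le_iff[OF assms, of t] by (cases "X t \<omega>") (auto simp: not_le[symmetric])

lemma sets_X_in: "B \<in> sets borel \<Longrightarrow> {\<omega> \<in> space M. X t \<omega> \<in> B} \<in> sets M"
  using measurable_sets[OF measurable_X, of B t] by (simp add: vimage_def Int_def conj_commute)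

lemma range_Some_borel: "range Some \<in> sets (borel :: 'a option measure)"
  by (simp add: open_Some_image)

lemma measurable_lifetime [measurable]: "lifetime X \<in> borel_measurable M"
proof (rule borel_measurableI_le)
  fix t
  have "{\<omega> \<in> space M. lifetime X \<omega> \<le> t} = space M - {\<omega> \<in> space M. X t \<omega> \<in> range Some}"
    using lifetime_le_iff by auto
  then show "{\<omega> \<in> space M. lifetime X \<omega> \<le> t} \<in> sets M"
    using sets_X_in[OF range_Some_borel] by simp
qed

lemma hitting_time_le: "X t \<omega> \<in> G \<Longrightarrow> hitting_time X G \<omega> \<le> t"
  by (auto simp: hitting_time_def intro: Inf_lower)

lemma eventually_at_right_X:
  assumes "\<omega> \<in> space M" "t < \<infinity>" "open V" "X t \<omega> \<in> V"
  obtains b where "t < b" "\<And>s. t \<le> s \<Longrightarrow> s < b \<Longrightarrow> X s \<omega> \<in> V"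
proof -
  have "\<forall>\<^sub>F s in at_right t. X s \<omega> \<in> V"
    using right_continuous_paths[OF assms(1,2)] assms(3,4) by (rule topological_tendstoD)
  then obtain b where "t < b" "\<And>s. t < s \<Longrightarrow> s < b \<Longrightarrow> X s \<omega> \<in> V"
    using eventually_at_right[of t \<infinity>] assms(2) by auto
  with assms(4) show ?thesis using that by (metis order_le_less)
qed

text \<open>Right-continuity keeps the path in the open set \<open>G\<close> for a while after it has entered, so
  rational times see the visit.\<close>

lemma hitting_time_less_iff:
  assumes "\<omega> \<in> space M" "open G"
  shows "hitting_time X G \<omega> < t \<longleftrightarrow> (\<exists>q::rat. ennreal (of_rat q) < t \<and> X (ennreal (of_rat q)) \<omega> \<in> G)"
proof
  assume "hitting_time X G \<omega> < t"
  then obtain s where s: "s < t" "X s \<omega> \<in> G" unfolding hitting_time_def Inf_less_iff by auto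
  then have "s < \<infinity>" by (metis infinity_ennreal_def order_less_le_trans top_greatest)
  then obtain b where b: "s < b" "\<And>r. s \<le> r \<Longrightarrow> r < b \<Longrightarrow> X r \<omega> \<in> G"
    using eventually_at_right_X[OF assms(1) _ assms(2) s(2)] by auto
  obtain q :: rat where "s < ennreal (of_rat q)" "ennreal (of_rat q) < min b t"
    using ennreal_rat_dense[of s "min b t"] b(1) s(1) by auto
  with b(2) show "\<exists>q::rat. ennreal (of_rat q) < t \<and> X (ennreal (of_rat q)) \<omega> \<in> G"
    by (metis less_imp_le min_less_iff_conj)
next
  assume "\<exists>q::rat. ennreal (of_rat q) < t \<and> X (ennreal (of_rat q)) \<omega> \<in> G"
  then show "hitting_time X G \<omega> < t" using hitting_time_le order_le_less_trans by blast
qed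

text \<open>For open \<open>G\<close> the event \<open>hitting_time X G < u\<close> is a countable union of events before \<open>u\<close>.  The passage
  from \<open>< u\<close> to \<open>\<le> t\<close> needs the right-continuity of the filtration.\<close>

lemma stopping_time_hitting_time:
  assumes "open G"
  shows "stopping_time F (hitting_time X G)"
proof (rule stopping_timeI)
  fix t
  have less: "{\<omega> \<in> space M. hitting_time X G \<omega> < u} \<in> sets (F s)" if "u \<le> s" for u s
  proof -
    have "{\<omega> \<in> space M. hitting_time X G \<omega> < u}
        = (\<Union>q\<in>{q::rat. ennreal (of_rat q) < u}. {\<omega> \<in> space M. X (ennreal (of_rat q)) \<omega> \<in> G})"
      using hitting_time_less_iff[OF _ assms] by auto
    moreover have "{\<omega> \<in> space M. X v \<omega> \<in> G} \<in> sets (F s)" if "v < u" for v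
    proof -
      have "{\<omega> \<in> space M. X v \<omega> \<in> G} \<in> sets (F v)"
        using measurable_sets[OF adapted[of v], of G] assms
        by (simp add: vimage_def Int_def conj_commute space_F)
      moreover have "v \<le> s" using that \<open>u \<le> s\<close> by simp
      ultimately show ?thesis using sets_F_mono by blast
    qed
    ultimately show ?thesis by (auto intro!: sets.countable_UN'')
  qed
  have "{\<omega> \<in> space M. hitting_time X G \<omega> \<le> t} \<in> sets (F t)"
  proof (cases "t < \<infinity>")
    case False
    then have "{\<omega> \<in> space M. hitting_time X G \<omega> \<le> t} = space (F t)" by (auto simp: not_less top_unique space_F)
    then show ?thesis by simp
  next
    case True
    have "{\<omega> \<in> space M. hitting_time X G \<omega> \<le> t} \<in> sets (F s)" if "t < s" for s
    proof -
      have "{\<omega> \<in> space M. hitting_time X G \<omega> \<le> t}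
          = space (F s) \<inter> (\<Inter>q\<in>{q::rat. t < ennreal (of_rat q) \<and> ennreal (of_rat q) < s}. {\<omega> \<in> space M. hitting_time X G \<omega> < ennreal (of_rat q)})"
      proof (intro subset_antisym subsetI)
        fix \<omega> assume "\<omega> \<in> {\<omega> \<in> space M. hitting_time X G \<omega> \<le> t}"
        then show "\<omega> \<in> space (F s) \<inter> (\<Inter>q\<in>{q::rat. t < ennreal (of_rat q) \<and> ennreal (of_rat q) < s}. {\<omega> \<in> space M. hitting_time X G \<omega> < ennreal (of_rat q)})"
          by (auto simp: space_F)
      next
        fix \<omega> assume \<omega>: "\<omega> \<in> space (F s) \<inter> (\<Inter>q\<in>{q::rat. t < ennreal (of_rat q) \<and> ennreal (of_rat q) < s}. {\<omega> \<in> space M. hitting_time X G \<omega> < ennreal (of_rat q)})"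
        have "\<not> t < hitting_time X G \<omega>"
        proof
          assume "t < hitting_time X G \<omega>"
          then obtain q :: rat where "t < ennreal (of_rat q)" "ennreal (of_rat q) < min s (hitting_time X G \<omega>)"
            using ennreal_rat_dense[of t "min s (hitting_time X G \<omega>)"] \<open>t < s\<close> by auto
          with \<omega> show False by (auto simp: not_less_iff_gr_or_eq)
        qed
        with \<omega> show "\<omega> \<in> {\<omega> \<in> space M. hitting_time X G \<omega> \<le> t}" by (auto simp: space_F)
      qed
      also have "\<dots> \<in> sets (F s)"
      proof (cases "{q::rat. t < ennreal (of_rat q) \<and> ennreal (of_rat q) < s} = {}")
        case True
        show ?thesis unfolding True by simp
      next
        case False
        then show ?thesis using less by (intro sets.Int sets.top sets.countable_INT') (auto simp: less_imp_le)
      qed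
      finally show ?thesis .
    qed
    then show ?thesis using right_continuous_F[OF True] by auto
  qed
  then show "Measurable.pred (F t) (\<lambda>\<omega>. hitting_time X G \<omega> \<le> t)"
    by (simp add: pred_def space_F)
qed

text \<open>At its hitting time the path is in the closure of \<open>G\<close>, possibly not in \<open>G\<close> itself.\<close>

lemma X_hitting_time_notin:
  assumes "\<omega> \<in> space M" "hitting_time X G \<omega> < \<infinity>" "open V" "V \<inter> G = {}"
  shows "X (hitting_time X G \<omega>) \<omega> \<notin> V"
proof
  assume "X (hitting_time X G \<omega>) \<omega> \<in> V"
  then obtain b where b: "hitting_time X G \<omega> < b" "\<And>s. hitting_time X G \<omega> \<le> s \<Longrightarrow> s < b \<Longrightarrow> X s \<omega> \<in> V"
    using eventually_at_right_X assms(1-3) by metis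
  then obtain s where "s < b" "X s \<omega> \<in> G" unfolding hitting_time_def Inf_less_iff by auto
  with b(2) assms(4) hitting_time_le show False by blast
qed

lemma finite_measure_subalgebra_pre_sigma:
  assumes "stopping_time F \<sigma>"
  shows "finite_measure_subalgebra (P x) (filtration.pre_sigma (space M) F \<sigma>)"
proof -
  interpret filtration "space M" F by (rule filtration_F)
  interpret prob_space "P x" by (rule prob_space_P)
  \<comment> \<open>Every value of \<open>\<sigma>\<close> is at most \<open>\<infinity>\<close>, which is itself an index of the filtration.\<close>
  have "A \<in> sets M" if "A \<in> sets (pre_sigma \<sigma>)" for A
    using sets_pre_sigmaD[OF assms that, of \<infinity>] sets_F_subset by auto
  then show ?thesis
    by unfold_locales (auto simp: subalgebra_def space_pre_sigma sets_P)
qed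

text \<open>The strong Markov property, integrated over an event \<open>S\<close> of the past.  The variable \<open>Y\<close> is the
  conditional probability.  It is integrable by construction, whereas integrating the transition
  probability from \<open>X\<^sub>\<sigma>\<close> would first require the measurability of \<open>X\<^sub>\<sigma>\<close>.\<close>

lemma strong_markov_measure:
  assumes \<sigma>: "stopping_time F \<sigma>" and S: "S \<in> sets (filtration.pre_sigma (space M) F \<sigma>)"
    and B: "B \<in> sets borel" and A: "{\<omega> \<in> space M. X (\<sigma> \<omega> + s) \<omega> \<in> B} \<in> sets M"
  obtains Y where "integrable (P x) Y"
    "AE \<omega> in P x. Y \<omega> = measure (P (X (\<sigma> \<omega>) \<omega>)) {\<omega>'\<in>space M. X s \<omega>' \<in> B}"
    "measure (P x) (S \<inter> {\<omega> \<in> space M. X (\<sigma> \<omega> + s) \<omega> \<in> B}) = (LINT \<omega>|P x. indicator S \<omega> * Y \<omega>)"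
    "S \<in> sets M"
proof -
  interpret finite_measure_subalgebra "P x" "filtration.pre_sigma (space M) F \<sigma>"
    using \<sigma> by (rule finite_measure_subalgebra_pre_sigma)
  define A where "A = {\<omega> \<in> space M. X (\<sigma> \<omega> + s) \<omega> \<in> B}"
  have [measurable]: "A \<in> sets (P x)" using A by (simp add: A_def sets_P)
  have S_M: "S \<in> sets (P x)" using S subalg by (auto simp: subalgebra_def)
  have int_A: "integrable (P x) (indicator A :: _ \<Rightarrow> real)"
    by (intro integrable_real_indicator) (simp_all add: less_top[symmetric])
  have "measure (P x) (S \<inter> A) = (LINT \<omega>|P x. indicator S \<omega> * indicator A \<omega>)"
    using sets.sets_into_space[OF S_M]
    by (simp add: indicator_inter_arith[symmetric] Int_absorb2 le_infI1)
  also have "\<dots> = (LINT \<omega>|P x. indicator S \<omega> * real_cond_exp (P x) (filtration.pre_sigma (space M) F \<sigma>) (indicator A) \<omega>)"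
    using real_cond_exp_intA[OF int_A S] by (simp add: set_lebesgue_integral_def)
  finally show ?thesis
    using that real_cond_exp_int(1)[OF int_A] strong_markov[OF \<sigma> B, of x s] S_M
    unfolding A_def sets_P by blast
qed

text \<open>A path with \<open>\<sigma> \<le> t\<close> that is alive at time \<open>2t\<close> is alive at time \<open>\<sigma> + t\<close>, that is, it survives
  for another time \<open>t\<close> after \<open>\<sigma>\<close>.  The advantage of the event at \<open>\<sigma> + t\<close> is that the strong Markov
  property applies to it with a constant time increment.\<close>

lemma exit_and_survive_le:
  assumes \<sigma>: "stopping_time F \<sigma>" and "0 \<le> e"
    and small: "\<And>\<omega>. \<omega> \<in> space M \<Longrightarrow> \<sigma> \<omega> \<le> t \<Longrightarrow>
      measure (P (X (\<sigma> \<omega>) \<omega>)) {\<omega>'\<in>space M. X t \<omega>' \<in> range Some} \<le> e"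
  shows "measure (P x) {\<omega> \<in> space M. \<sigma> \<omega> \<le> t \<and> X (t + t) \<omega> \<in> range Some} \<le> e"
proof -
  interpret prob_space "P x" by (rule prob_space_P)
  interpret fil: filtration "space M" F by (rule filtration_F)
  define S where "S = {\<omega> \<in> space M. \<sigma> \<omega> \<le> t}"
  have [measurable]: "\<sigma> \<in> borel_measurable M"
    using measurable_stopping_time[OF \<sigma>] sets_F_subset space_F by blast
  have S: "S \<in> sets (fil.pre_sigma \<sigma>)"
    using measurable_sets[OF fil.measurable_stopping_time_pre_sigma[OF \<sigma>], of "{..t}"]
    by (simp add: S_def fil.space_pre_sigma vimage_def Int_def conj_commute)
  have "{\<omega> \<in> space M. X (\<sigma> \<omega> + t) \<omega> \<in> range Some} = {\<omega> \<in> space M. \<sigma> \<omega> + t < lifetime X \<omega>}"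
    using less_lifetime_iff by blast
  then have A: "{\<omega> \<in> space M. X (\<sigma> \<omega> + t) \<omega> \<in> range Some} \<in> sets M" by simp
  obtain Y where Y: "integrable (P x) Y"
    "AE \<omega> in P x. Y \<omega> = measure (P (X (\<sigma> \<omega>) \<omega>)) {\<omega>'\<in>space M. X t \<omega>' \<in> range Some}"
    "measure (P x) (S \<inter> {\<omega> \<in> space M. X (\<sigma> \<omega> + t) \<omega> \<in> range Some}) = (LINT \<omega>|P x. indicator S \<omega> * Y \<omega>)"
    and S_M: "S \<in> sets M"
    using strong_markov_measure[OF \<sigma> S range_Some_borel A, of x] by blast
  have "measure (P x) {\<omega> \<in> space M. \<sigma> \<omega> \<le> t \<and> X (t + t) \<omega> \<in> range Some}
      \<le> measure (P x) (S \<inter> {\<omega> \<in> space M. X (\<sigma> \<omega> + t) \<omega> \<in> range Some})"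
  proof (rule finite_measure_mono)
    have "X (\<sigma> \<omega> + t) \<omega> \<in> range Some" if "\<omega> \<in> space M" "\<sigma> \<omega> \<le> t" "X (t + t) \<omega> \<in> range Some" for \<omega>
    proof -
      have "\<sigma> \<omega> + t \<le> t + t" using that(2) by (intro add_right_mono)
      also have "t + t < lifetime X \<omega>" using that(3) less_lifetime_iff[OF that(1)] by simp
      finally show ?thesis using less_lifetime_iff[OF that(1)] by simp
    qed
    then show "{\<omega> \<in> space M. \<sigma> \<omega> \<le> t \<and> X (t + t) \<omega> \<in> range Some}
        \<subseteq> S \<inter> {\<omega> \<in> space M. X (\<sigma> \<omega> + t) \<omega> \<in> range Some}"
      by (auto simp: S_def)
    show "S \<inter> {\<omega> \<in> space M. X (\<sigma> \<omega> + t) \<omega> \<in> range Some} \<in> events"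
      using S_M A by (simp add: sets_P)
  qed
  also have "\<dots> = (LINT \<omega>|P x. indicator S \<omega> * Y \<omega>)" by (rule Y(3))
  also have "\<dots> \<le> (LINT \<omega>|P x. e)"
  proof (rule integral_mono_AE)
    show "integrable (P x) (\<lambda>\<omega>. indicator S \<omega> * Y \<omega>)"
      using integrable_mult_indicator[of S "P x" Y] S_M Y(1) by (simp add: sets_P)
    show "AE \<omega> in P x. indicator S \<omega> * Y \<omega> \<le> e"
      using Y(2) AE_space
    proof eventually_elim
      fix \<omega> assume "Y \<omega> = measure (P (X (\<sigma> \<omega>) \<omega>)) {\<omega>'\<in>space M. X t \<omega>' \<in> range Some}" "\<omega> \<in> space (P x)"
      then show "indicator S \<omega> * Y \<omega> \<le> e"
        using small[of \<omega>] \<open>0 \<le> e\<close> by (cases "\<omega> \<in> S") (simp_all add: S_def)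
    qed
  qed simp
  also have "\<dots> = e" using prob_space by simp
  finally show ?thesis .
qed


section \<open>The part process\<close>

text \<open>The exit time from \<open>U\<close> is a hitting time of a closed set, so the argument for open sets does not
  apply to it.  The exit times from the compact sets \<open>C n\<close> are hitting times of open sets and increase to
  a limit that is at most the exit time from \<open>U\<close>.  Quasi-left-continuity identifies the position at the
  limit time as the limit of the positions, which lies outside of every \<open>V n\<close>, hence outside of \<open>U\<close>.
  The start in \<open>U\<close> makes the limit positive, which matters because the exit time ignores time \<open>0\<close>.\<close>

lemma exit_time_eq_SUP_hitting_time:
  assumes V: "\<And>n. open (V n)" "\<And>n. V n \<subseteq> C n" "incseq V"
    and C: "\<And>n. compact (C n)" "\<And>n. closed (C n)" "incseq C" "\<And>n. C n \<subseteq> U"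
    and U: "U = (\<Union>n. V n)" and x: "x \<in> U"
  shows "AE \<omega> in P (Some x). exit_time X U \<omega> = (SUP n. hitting_time X (- Some ` C n) \<omega>)"
proof -
  define \<sigma> where "\<sigma> n = hitting_time X (- Some ` C n)" for n
  have stop: "stopping_time F (\<sigma> n)" for n
    unfolding \<sigma>_def using C by (intro stopping_time_hitting_time open_Compl_Some_image)
  have mono: "\<sigma> n \<omega> \<le> \<sigma> (Suc n) \<omega>" for n \<omega>
    unfolding \<sigma>_def hitting_time_def using incseq_SucD[OF C(3)] by (intro Inf_superset_mono) auto
  have "AE \<omega> in P (Some x). (SUP n. \<sigma> n \<omega>) < \<infinity> \<longrightarrow> (\<lambda>n. X (\<sigma> n \<omega>) \<omega>) \<longlonglongrightarrow> X (SUP n. \<sigma> n \<omega>) \<omega>"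
    by (rule quasi_left_continuous[where \<sigma> = \<sigma>]) (rule stop mono)+
  then have "AE \<omega> in P (Some x). exit_time X U \<omega> = (SUP n. \<sigma> n \<omega>)"
    using normal[of "Some x"] AE_space
  proof eventually_elim
    fix \<omega> assume lim: "(SUP n. \<sigma> n \<omega>) < \<infinity> \<longrightarrow> (\<lambda>n. X (\<sigma> n \<omega>) \<omega>) \<longlonglongrightarrow> X (SUP n. \<sigma> n \<omega>) \<omega>"
      and start: "X 0 \<omega> = Some x" and "\<omega> \<in> space (P (Some x))"
    then have \<omega>: "\<omega> \<in> space M" by simp
    show "exit_time X U \<omega> = (SUP n. \<sigma> n \<omega>)"
    proof (rule antisym)
      show "(SUP n. \<sigma> n \<omega>) \<le> exit_time X U \<omega>"
        unfolding exit_time_def \<sigma>_def using C(4) by (intro SUP_least Inf_greatest hitting_time_le) auto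
      show "exit_time X U \<omega> \<le> (SUP n. \<sigma> n \<omega>)"
      proof (cases "(SUP n. \<sigma> n \<omega>) < \<infinity>")
        case True
        have outside: "X (SUP n. \<sigma> n \<omega>) \<omega> \<notin> Some ` V m" for m
        proof
          assume "X (SUP n. \<sigma> n \<omega>) \<omega> \<in> Some ` V m"
          then have "\<forall>\<^sub>F n in sequentially. X (\<sigma> n \<omega>) \<omega> \<in> Some ` V m"
            using lim True V(1) by (intro topological_tendstoD[OF _ open_Some_image]) auto
          then obtain n where n: "n \<ge> m" "X (\<sigma> n \<omega>) \<omega> \<in> Some ` V m"
            unfolding eventually_sequentially by (metis nat_le_linear)
          have "\<sigma> n \<omega> < \<infinity>" using True SUP_upper[of n UNIV "\<lambda>n. \<sigma> n \<omega>"] by (simp add: le_less_trans)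
          then have "X (\<sigma> n \<omega>) \<omega> \<notin> Some ` V n"
            unfolding \<sigma>_def using \<omega> V by (intro X_hitting_time_notin open_Some_image) auto
          moreover have "V m \<subseteq> V n" using V(3) n(1) by (rule incseqD)
          ultimately show False using n(2) by blast
        qed
        then have exit: "X (SUP n. \<sigma> n \<omega>) \<omega> \<notin> Some ` U" using U by auto
        then have "(SUP n. \<sigma> n \<omega>) \<noteq> 0" using start x by (metis imageI)
        with exit show ?thesis
          unfolding exit_time_def by (intro Inf_lower) (simp add: zero_less_iff_neq_zero)
      next
        case False
        then have "(SUP n. \<sigma> n \<omega>) = \<top>" by (simp only: infinity_ennreal_def not_less top_unique)
        then show ?thesis by (simp only: top_greatest)
      qed
    qed
  qed
  then show ?thesis by (simp add: \<sigma>_def)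
qed

text \<open>A measurable version \<open>\<tau>\<close> of the exit time shows that the event in the definition of the part
  process is measurable for the completion, so the integral there has its intended value.\<close>

lemma part_op_eq_integral:
  assumes \<tau> [measurable]: "\<tau> \<in> borel_measurable M" and exit: "AE \<omega> in P (Some x). exit_time X U \<omega> = \<tau> \<omega>"
    and f: "f \<in> borel_measurable borel"
  shows "part_op X P U t f x
    = (LINT \<omega>|P (Some x). indicator {\<omega> \<in> space M. ennreal t < \<tau> \<omega>} \<omega> * extend_zero f (X (ennreal t) \<omega>))"
proof -
  let ?Q = "completion (P (Some x))"
  define S where "S = {\<omega> \<in> space M. ennreal t < \<tau> \<omega>}"
  define D where "D = {\<omega> \<in> space M. ennreal t < exit_time X U \<omega>}"
  have [measurable]: "S \<in> sets (P (Some x))" by (simp add: S_def sets_P)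
  have f_X [measurable]: "(\<lambda>\<omega>. extend_zero f (X (ennreal t) \<omega>)) \<in> borel_measurable (P (Some x))"
    by (rule measurable_compose[OF measurable_X_P borel_measurable_extend_zero[OF f]])
  have DS: "AE \<omega> in ?Q. \<omega> \<in> S \<longleftrightarrow> \<omega> \<in> D"
    using AE_completion[OF exit] by eventually_elim (auto simp: S_def D_def)
  have D: "D \<in> sets ?Q"
    by (rule completion.in_sets_AE[OF DS]) (auto simp: D_def)
  have "part_op X P U t f x = (LINT \<omega>|?Q. indicator D \<omega> * extend_zero f (X (ennreal t) \<omega>))"
    unfolding part_op_def by (rule Bochner_Integration.integral_cong) (auto simp: D_def indicator_def)
  also have "\<dots> = (LINT \<omega>|?Q. indicator S \<omega> * extend_zero f (X (ennreal t) \<omega>))"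
  proof (rule integral_cong_AE)
    show "AE \<omega> in ?Q. indicator D \<omega> * extend_zero f (X (ennreal t) \<omega>) = indicator S \<omega> * extend_zero f (X (ennreal t) \<omega>)"
      using DS by eventually_elim (auto simp: indicator_def)
    show "(\<lambda>\<omega>. indicator D \<omega> * extend_zero f (X (ennreal t) \<omega>)) \<in> borel_measurable ?Q"
      using D by (intro borel_measurable_times borel_measurable_indicator measurable_completion[OF f_X])
    show "(\<lambda>\<omega>. indicator S \<omega> * extend_zero f (X (ennreal t) \<omega>)) \<in> borel_measurable ?Q"
      by (intro measurable_completion) measurable
  qed
  also have "\<dots> = (LINT \<omega>|P (Some x). indicator S \<omega> * extend_zero f (X (ennreal t) \<omega>))"
    by (rule integral_completion) measurable
  finally show ?thesis by (simp add: S_def)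
qed

lemma trans_op_indicator:
  assumes "A \<in> sets borel"
  shows "trans_op X P t (indicator A) x = measure (P (Some x)) {\<omega> \<in> space M. X (ennreal t) \<omega> \<in> Some ` A}"
proof -
  have "{\<omega> \<in> space M. X (ennreal t) \<omega> \<in> Some ` A} \<in> sets (P (Some x))"
    using sets_X_in[OF sets_borel_Some_image[OF assms]] by (simp add: sets_P)
  moreover have "extend_zero (indicator A) z = (indicator (Some ` A) z :: real)" for z
    by (cases z) (auto simp: indicator_def)
  then have "trans_op X P t (indicator A) x
      = (LINT \<omega>|P (Some x). indicator {\<omega> \<in> space M. X (ennreal t) \<omega> \<in> Some ` A} \<omega>)"
    unfolding trans_op_def by (intro Bochner_Integration.integral_cong) (auto simp: indicator_def)
  ultimately show ?thesis by (simp add: Int_absorb2)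
qed

lemma transition_from_cemetery_eq_0: "measure (P None) {\<omega> \<in> space M. X t \<omega> \<in> Some ` A} = 0"
proof -
  have *: "AE \<omega> in P None. \<omega> \<notin> {\<omega> \<in> space M. X t \<omega> \<in> Some ` A}"
    using cemetery_trap[of t] by eventually_elim auto
  then show ?thesis
  proof (cases "{\<omega> \<in> space M. X t \<omega> \<in> Some ` A} \<in> sets (P None)")
    case True
    with * have "{\<omega> \<in> space M. X t \<omega> \<in> Some ` A} \<in> null_sets (P None)"
      by (simp only: AE_iff_null_sets)
    then show ?thesis by (rule measure_eq_0_null_sets)
  qed (rule measure_notin_sets)
qed

lemma extend_zero_trans_op_indicator:
  assumes "A \<in> sets borel"
  shows "extend_zero (trans_op X P t (indicator A)) z = measure (P z) {\<omega> \<in> space M. X (ennreal t) \<omega> \<in> Some ` A}"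
  by (cases z) (simp_all add: trans_op_indicator[OF assms] transition_from_cemetery_eq_0)

text \<open>At a constant time the position is measurable, and the conditional probability can be replaced by
  the transition probability.\<close>

lemma markov_measure:
  assumes S: "S \<in> sets (F t)" and B: "B \<in> sets borel"
  shows "measure (P x) (S \<inter> {\<omega> \<in> space M. X (t + s) \<omega> \<in> B})
    = (LINT \<omega>|P x. indicator S \<omega> * measure (P (X t \<omega>)) {\<omega>'\<in>space M. X s \<omega>' \<in> B})"
proof -
  interpret fil: filtration "space M" F by (rule filtration_F)
  have pre: "S \<in> sets (fil.pre_sigma (\<lambda>_. t))"
  proof (intro fil.sets_pre_sigmaI stopping_time_const)
    fix u
    show "{\<omega> \<in> S. t \<le> u} \<in> sets (F u)"
      using subsetD[OF sets_F_mono S, of u] by (cases "t \<le> u") simp_all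
  qed
  obtain Y where Y: "integrable (P x) Y"
    "AE \<omega> in P x. Y \<omega> = measure (P (X t \<omega>)) {\<omega>'\<in>space M. X s \<omega>' \<in> B}"
    "measure (P x) (S \<inter> {\<omega> \<in> space M. X (t + s) \<omega> \<in> B}) = (LINT \<omega>|P x. indicator S \<omega> * Y \<omega>)"
    "S \<in> sets M"
    by (rule strong_markov_measure[where \<sigma> = "\<lambda>_. t" and S = S and B = B and x = x and s = s,
          OF stopping_time_const pre B sets_X_in[OF B]]) (rule that)
  have [measurable]: "S \<in> sets (P x)" using Y(4) by (simp add: sets_P)
  have [measurable]: "(\<lambda>\<omega>. measure (P (X t \<omega>)) {\<omega>'\<in>space M. X s \<omega>' \<in> B}) \<in> borel_measurable (P x)"
    by (rule measurable_compose[OF measurable_X_P measurable_transition[OF B]])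
  have [measurable]: "Y \<in> borel_measurable (P x)" using Y(1) by simp
  show ?thesis
    unfolding Y(3)
  proof (rule integral_cong_AE)
    show "AE \<omega> in P x. indicator S \<omega> * Y \<omega> = indicator S \<omega> * measure (P (X t \<omega>)) {\<omega>'\<in>space M. X s \<omega>' \<in> B}"
      using Y(2) by eventually_elim simp
  qed measurable
qed

lemma measurable_trans_op_indicator:
  assumes "A \<in> sets borel"
  shows "trans_op X P t (indicator A) \<in> borel_measurable borel"
proof -
  have "(\<lambda>x. measure (P (Some x)) {\<omega> \<in> space M. X (ennreal t) \<omega> \<in> Some ` A}) \<in> borel_measurable borel"
    by (rule measurable_compose[OF measurable_Some_option measurable_transition[OF sets_borel_Some_image[OF assms]]])
  moreover have "trans_op X P t (indicator A) = (\<lambda>x. measure (P (Some x)) {\<omega> \<in> space M. X (ennreal t) \<omega> \<in> Some ` A})"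
    using trans_op_indicator[OF assms] by (rule ext)
  ultimately show ?thesis by simp
qed

lemma trans_op_indicator_bounds:
  assumes "A \<in> sets borel"
  shows "0 \<le> trans_op X P t (indicator A) x" "trans_op X P t (indicator A) x \<le> 1"
proof -
  interpret prob_space "P (Some x)" by (rule prob_space_P)
  show "0 \<le> trans_op X P t (indicator A) x" "trans_op X P t (indicator A) x \<le> 1"
    by (simp_all add: trans_op_indicator[OF assms])
qed

text \<open>The Markov property at time \<open>t\<close> gives \<open>p\<^sub>t\<^sup>U (p\<^sub>t 1\<^sub>A) (x)\<close> as the probability that the path is in \<open>A\<close>
  at time \<open>2t\<close> and has not left \<open>U\<close> up to time \<open>t\<close>.  The missing paths leave \<open>C N\<close> by time \<open>t\<close>, hence at a
  position outside of \<open>K\<close>, and are alive at time \<open>2t\<close>.\<close>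

lemma trans_op_double_time_near_part_op:
  assumes V: "\<And>n. open (V n)" "\<And>n. V n \<subseteq> C n" "incseq V"
    and C: "\<And>n. compact (C n)" "\<And>n. closed (C n)" "incseq C" "\<And>n. C n \<subseteq> U"
    and U: "U = (\<Union>n. V n)" and x: "x \<in> U" and t: "0 < t"
    and K: "K \<subseteq> V N" "\<And>y. y \<notin> K \<Longrightarrow> measure (P (Some y)) {\<omega> \<in> space M. X (ennreal t) \<omega> \<in> range Some} \<le> e"
    and e: "0 \<le> e" and A: "A \<in> sets borel"
  shows "\<bar>trans_op X P (t + t) (indicator A) x - part_op X P U t (trans_op X P t (indicator A)) x\<bar> \<le> e"
proof -
  interpret prob_space "P (Some x)" by (rule prob_space_P)
  define \<sigma> where "\<sigma> n = hitting_time X (- Some ` C n)" for n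
  define \<tau> where "\<tau> \<omega> = (SUP n. \<sigma> n \<omega>)" for \<omega>
  have stop: "stopping_time F (\<sigma> n)" for n
    unfolding \<sigma>_def using C by (intro stopping_time_hitting_time open_Compl_Some_image)
  have [measurable]: "\<sigma> n \<in> borel_measurable M" for n
    using measurable_stopping_time[OF stop] sets_F_subset space_F by blast
  have \<tau>_meas: "\<tau> \<in> borel_measurable M"
    unfolding \<tau>_def by measurable
  define S where "S = {\<omega> \<in> space M. ennreal t < \<tau> \<omega>}"
  have S: "S \<in> sets (F (ennreal t))"
  proof -
    have "S = (\<Union>n. {\<omega> \<in> space (F (ennreal t)). ennreal t < \<sigma> n \<omega>})"
      by (auto simp: S_def \<tau>_def less_SUP_iff space_F)
    then show ?thesis
      using stopping_timeD2[OF stop] by (auto simp: pred_def)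
  qed
  define B where "B = {\<omega> \<in> space M. X (ennreal t + ennreal t) \<omega> \<in> Some ` A}"
  have B: "B \<in> events"
    using sets_X_in[OF sets_borel_Some_image[OF A]] by (simp add: B_def sets_P)
  have "part_op X P U t (trans_op X P t (indicator A)) x
      = (LINT \<omega>|P (Some x). indicator S \<omega> * extend_zero (trans_op X P t (indicator A)) (X (ennreal t) \<omega>))"
    unfolding S_def
    using exit_time_eq_SUP_hitting_time[OF V C U x] measurable_trans_op_indicator[OF A]
    by (intro part_op_eq_integral[OF \<tau>_meas]) (simp_all add: \<tau>_def \<sigma>_def)
  also have "\<dots> = prob (S \<inter> B)"
    unfolding B_def using markov_measure[OF S sets_borel_Some_image[OF A]]
    by (simp add: extend_zero_trans_op_indicator[OF A])
  finally have part: "part_op X P U t (trans_op X P t (indicator A)) x = prob (B \<inter> S)"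
    by (simp add: Int_commute)
  have "S \<in> events" using S sets_F_subset by (auto simp: sets_P)
  then have "prob B - prob (B \<inter> S) = prob (B - S)"
    using B by (simp add: finite_measure_Diff')
  moreover have "ennreal (t + t) = ennreal t + ennreal t"
    using t by (intro ennreal_plus) auto
  then have "trans_op X P (t + t) (indicator A) x = prob B"
    by (simp only: trans_op_indicator[OF A] B_def)
  moreover have "prob (B - S) \<le> prob {\<omega> \<in> space M. \<sigma> N \<omega> \<le> ennreal t \<and> X (ennreal t + ennreal t) \<omega> \<in> range Some}"
  proof (rule finite_measure_mono)
    show "B - S \<subseteq> {\<omega> \<in> space M. \<sigma> N \<omega> \<le> ennreal t \<and> X (ennreal t + ennreal t) \<omega> \<in> range Some}"
      by (auto simp: B_def S_def \<tau>_def not_less SUP_le_iff)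
    have "{\<omega> \<in> space M. \<sigma> N \<omega> \<le> ennreal t \<and> X (ennreal t + ennreal t) \<omega> \<in> range Some}
        = {\<omega> \<in> space M. \<sigma> N \<omega> \<le> ennreal t} \<inter> {\<omega> \<in> space M. X (ennreal t + ennreal t) \<omega> \<in> range Some}"
      by auto
    then show "{\<omega> \<in> space M. \<sigma> N \<omega> \<le> ennreal t \<and> X (ennreal t + ennreal t) \<omega> \<in> range Some} \<in> events"
      using sets_X_in[OF range_Some_borel] by (simp add: sets_P)
  qed
  moreover have "prob {\<omega> \<in> space M. \<sigma> N \<omega> \<le> ennreal t \<and> X (ennreal t + ennreal t) \<omega> \<in> range Some} \<le> e"
  proof (rule exit_and_survive_le[OF stop e])
    fix \<omega> assume \<omega>: "\<omega> \<in> space M" "\<sigma> N \<omega> \<le> ennreal t"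
    have "X (\<sigma> N \<omega>) \<omega> \<notin> Some ` V N"
      using \<omega> V le_less_trans[OF \<omega>(2) ennreal_less_top] unfolding \<sigma>_def
      by (intro X_hitting_time_notin open_Some_image) auto
    then show "measure (P (X (\<sigma> N \<omega>) \<omega>)) {\<omega>' \<in> space M. X (ennreal t) \<omega>' \<in> range Some} \<le> e"
      using K e by (cases "X (\<sigma> N \<omega>) \<omega>") (auto simp: transition_from_cemetery_eq_0)
  qed
  moreover have "0 \<le> prob (B - S)" by simp
  ultimately show ?thesis unfolding part by linarith
qed

section \<open>Survival probabilities and the resolvent\<close>

text \<open>A path that is alive at time \<open>t\<close> contributes at least \<open>t exp (- t)\<close>, the integral of the constant
  \<open>exp (- t)\<close> over \<open>[0, t]\<close>, to the resolvent.\<close>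

lemma survival_le_resolvent:
  assumes t: "0 < t"
  shows "t * exp (- t) * measure (P (Some x)) {\<omega> \<in> space M. X (ennreal t) \<omega> \<in> range Some}
    \<le> resolvent_op X P 1 (\<lambda>_. 1) x"
proof -
  interpret prob_space "P (Some x)" by (rule prob_space_P)
  define J where "J \<omega> = (LINT s|lborel. indicator {s. 0 \<le> s \<and> ennreal s < lifetime X \<omega>} s * exp (- s))" for \<omega>
  have res: "resolvent_op X P 1 (\<lambda>_. 1) x = expectation J"
    unfolding resolvent_op_def J_def set_lebesgue_integral_def
  proof (intro Bochner_Integration.integral_cong refl)
    fix \<omega> s assume "\<omega> \<in> space (P (Some x))"
    then have "X (ennreal s) \<omega> \<in> range Some" if "ennreal s < lifetime X \<omega>"
      using that by (simp add: less_lifetime_iff)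
    then show "indicat_real {t. 0 \<le> t \<and> ennreal t < lifetime X \<omega>} s *\<^sub>R (exp (- 1 * s) * extend_zero (\<lambda>_. 1) (X (ennreal s) \<omega>))
        = indicator {s. 0 \<le> s \<and> ennreal s < lifetime X \<omega>} s * exp (- s)"
      by (auto simp: indicator_def)
  qed
  have [measurable]: "lifetime X \<in> borel_measurable (P (Some x))"
    by (simp add: measurable_P_iff)
  have J_meas [measurable]: "J \<in> borel_measurable (P (Some x))"
    unfolding J_def by measurable
  have exp_int: "integrable lborel (\<lambda>s::real. indicator {0<..} s * exp (- s))"
    using integrable_I0i_exp_mscale[of 1] by (simp add: set_integrable_def)
  \<comment> \<open>The dominating function is integrable over the open half-line, so the point \<open>0\<close> is left out.\<close>
  have le_exp: "AE s in lborel. norm (indicat_real {s. 0 \<le> s \<and> ennreal s < lifetime X \<omega>} s * exp (- s))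
      \<le> indicator {0<..} s * exp (- s)" for \<omega>
    using AE_lborel_singleton[of 0] by eventually_elim (auto simp: indicator_def)
  have life_int: "integrable lborel (\<lambda>s. indicator {s. 0 \<le> s \<and> ennreal s < lifetime X \<omega>} s * exp (- s))" for \<omega>
    by (rule Bochner_Integration.integrable_bound[OF exp_int])
      (use le_exp[of \<omega>] in \<open>auto elim!: eventually_mono\<close>)
  have J_le: "J \<omega> \<le> (LINT s|lborel. indicator {0<..} s * exp (- s))" for \<omega>
    unfolding J_def using le_exp[of \<omega>] by (intro integral_mono_AE life_int exp_int) (auto elim!: eventually_mono)
  have J_nonneg: "0 \<le> J \<omega>" for \<omega>
    unfolding J_def by (intro integral_nonneg_AE) auto
  have J_int: "integrable (P (Some x)) J"
    using J_le J_nonneg by (intro integrable_const_bound[of _ "LINT s|lborel. indicator {0<..} s * exp (- s)"]) auto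
  define E where "E = {\<omega> \<in> space M. X (ennreal t) \<omega> \<in> range Some}"
  have E [measurable]: "E \<in> events"
    using sets_X_in[OF range_Some_borel] by (simp add: E_def sets_P)
  have J_ge: "t * exp (- t) \<le> J \<omega>" if "\<omega> \<in> E" for \<omega>
  proof -
    have alive: "ennreal t < lifetime X \<omega>" using that less_lifetime_iff by (simp add: E_def)
    have "(LINT s|lborel. indicator {0..t} s * exp (- t)) \<le> J \<omega>"
      unfolding J_def
    proof (intro integral_mono life_int)
      fix s :: real
      show "indicator {0..t} s * exp (- t) \<le> indicator {s. 0 \<le> s \<and> ennreal s < lifetime X \<omega>} s * exp (- s)"
      proof (cases "0 \<le> s \<and> s \<le> t")
        case True
        then have "ennreal s < lifetime X \<omega>" using alive by (meson ennreal_leI le_less_trans)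
        with True show ?thesis by simp
      qed (auto simp: indicator_def)
    qed (use t in \<open>intro integrable_mult_left integrable_real_indicator; simp\<close>)
    then show ?thesis using t by simp
  qed
  have "t * exp (- t) * prob E = expectation (\<lambda>\<omega>. t * exp (- t) * indicator E \<omega>)"
    using E sets.sets_into_space[OF E] by (simp add: Int_absorb2)
  also have "\<dots> \<le> expectation J"
  proof (intro integral_mono J_int)
    fix \<omega>
    show "t * exp (- t) * indicator E \<omega> \<le> J \<omega>"
      using J_ge[of \<omega>] J_nonneg[of \<omega>] by (cases "\<omega> \<in> E") auto
  qed (use E in \<open>simp add: less_top[symmetric]\<close>)
  finally show ?thesis by (simp add: res E_def)
qed


lemma trans_op_indicator_le_survival:
  assumes t: "0 < t" and A: "A \<in> sets borel"
  shows "trans_op X P (t + t) (indicator A) x \<le> measure (P (Some x)) {\<omega> \<in> space M. X (ennreal t) \<omega> \<in> range Some}"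
proof -
  interpret prob_space "P (Some x)" by (rule prob_space_P)
  have le: "ennreal t \<le> ennreal (t + t)" using t by (intro ennreal_leI) simp
  have "X (ennreal t) \<omega> \<in> range Some" if "\<omega> \<in> space M" "X (ennreal (t + t)) \<omega> \<in> Some ` A" for \<omega>
  proof -
    have "ennreal (t + t) < lifetime X \<omega>" using that less_lifetime_iff[OF that(1)] by auto
    with le have "ennreal t < lifetime X \<omega>" by (rule le_less_trans)
    then show ?thesis using less_lifetime_iff[OF that(1)] by simp
  qed
  then show ?thesis
    unfolding trans_op_indicator[OF A] using sets_X_in[OF range_Some_borel]
    by (intro finite_measure_mono) (auto simp: sets_P)
qed

section \<open>The semigroup on integrable functions\<close>

lemma measurable_transition_kernel:
  "(\<lambda>x. distr (P (Some x)) borel (X t)) \<in> borel \<rightarrow>\<^sub>M subprob_algebra borel"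
proof (rule measurable_subprob_algebra)
  fix x
  interpret prob_space "P (Some x)" by (rule prob_space_P)
  show "subprob_space (distr (P (Some x)) borel (X t))"
    by (intro prob_space_imp_subprob_space prob_space_distr) simp
next
  fix B :: "'a option set" assume B: "B \<in> sets borel"
  have "emeasure (distr (P (Some x)) borel (X t)) B = ennreal (measure (P (Some x)) {\<omega> \<in> space M. X t \<omega> \<in> B})" for x
  proof -
    interpret prob_space "P (Some x)" by (rule prob_space_P)
    have "emeasure (distr (P (Some x)) borel (X t)) B = emeasure (P (Some x)) {\<omega> \<in> space M. X t \<omega> \<in> B}"
      using B by (simp add: emeasure_distr vimage_def Int_def conj_commute)
    then show ?thesis by (simp add: emeasure_eq_measure)
  qed
  moreover have "(\<lambda>x. ennreal (measure (P (Some x)) {\<omega> \<in> space M. X t \<omega> \<in> B})) \<in> borel_measurable borel"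
    using measurable_compose[OF measurable_Some_option measurable_transition[OF B]] by measurable
  ultimately show "(\<lambda>x. emeasure (distr (P (Some x)) borel (X t)) B) \<in> borel_measurable borel"
    by simp
qed simp

lemma measurable_nn_trans:
  fixes g :: "'a \<Rightarrow> ennreal"
  assumes "g \<in> borel_measurable borel"
  shows "(\<lambda>x. \<integral>\<^sup>+\<omega>. extend_zero g (X t \<omega>) \<partial>P (Some x)) \<in> borel_measurable borel"
proof -
  have ext: "extend_zero g \<in> borel_measurable borel"
    using assms by (rule borel_measurable_extend_zero)
  have "(\<lambda>x. \<integral>\<^sup>+z. extend_zero g z \<partial>distr (P (Some x)) borel (X t)) \<in> borel_measurable borel"
    by (rule measurable_compose[OF measurable_transition_kernel nn_integral_measurable_subprob_algebra[OF ext]])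
  then show ?thesis by (simp add: nn_integral_distr ext)
qed

lemma measurable_trans_op:
  assumes "f \<in> borel_measurable borel"
  shows "trans_op X P t f \<in> borel_measurable borel"
proof -
  have ext: "extend_zero f \<in> borel_measurable borel"
    using assms by (rule borel_measurable_extend_zero)
  have "(\<lambda>x. LINT z|distr (P (Some x)) borel (X (ennreal t)). extend_zero f z) \<in> borel_measurable borel"
    by (rule measurable_compose[OF measurable_transition_kernel integral_measurable_subprob_algebra[OF ext]])
  moreover have "trans_op X P t f = (\<lambda>x. LINT z|distr (P (Some x)) borel (X (ennreal t)). extend_zero f z)"
    by (simp add: fun_eq_iff trans_op_def integral_distr ext)
  ultimately show ?thesis by simp
qed

text \<open>Contractivity on \<open>L\<^sup>1\<close>: symmetry moves the operator to the constant function \<open>1\<close>, where it is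
  sub-Markovian.\<close>

lemma nn_integral_trans_le:
  fixes g :: "'a \<Rightarrow> ennreal"
  assumes sym: "symmetric_process \<mu> X P" and t: "0 < t" and g: "g \<in> borel_measurable borel"
  shows "(\<integral>\<^sup>+x. (\<integral>\<^sup>+\<omega>. extend_zero g (X (ennreal t) \<omega>) \<partial>P (Some x)) \<partial>\<mu>) \<le> (\<integral>\<^sup>+x. g x \<partial>\<mu>)"
proof -
  have "(\<integral>\<^sup>+x. 1 * (\<integral>\<^sup>+\<omega>. extend_zero g (X (ennreal t) \<omega>) \<partial>P (Some x)) \<partial>\<mu>)
      = (\<integral>\<^sup>+x. (\<integral>\<^sup>+\<omega>. extend_zero (\<lambda>_. 1) (X (ennreal t) \<omega>) \<partial>P (Some x)) * g x \<partial>\<mu>)"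
    using t g by (intro sym[unfolded symmetric_process_def, rule_format]) auto
  also have "\<dots> \<le> (\<integral>\<^sup>+x. 1 * g x \<partial>\<mu>)"
  proof (intro nn_integral_mono mult_right_mono)
    fix x
    interpret prob_space "P (Some x)" by (rule prob_space_P)
    have "extend_zero (\<lambda>_. 1) z \<le> (1 :: ennreal)" for z :: "'a option" by (cases z) simp_all
    then have "(\<integral>\<^sup>+\<omega>. extend_zero (\<lambda>_. 1) (X (ennreal t) \<omega>) \<partial>P (Some x)) \<le> (\<integral>\<^sup>+\<omega>. 1 \<partial>P (Some x))"
      by (intro nn_integral_mono)
    then show "(\<integral>\<^sup>+\<omega>. extend_zero (\<lambda>_. 1) (X (ennreal t) \<omega>) \<partial>P (Some x)) \<le> 1"
      using emeasure_space_1 by simp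
  qed simp
  finally show ?thesis by simp
qed

lemma AE_integrable_trans:
  fixes f :: "'a \<Rightarrow> real"
  assumes sym: "symmetric_process \<mu> X P" and sets: "sets \<mu> = sets borel" and t: "0 < t" and f: "integrable \<mu> f"
  shows "AE x in \<mu>. integrable (P (Some x)) (\<lambda>\<omega>. extend_zero f (X (ennreal t) \<omega>))"
proof -
  have f_meas: "f \<in> borel_measurable borel"
    using borel_measurable_integrable[OF f] by (simp add: measurable_cong_sets[OF sets refl])
  then have g_meas: "(\<lambda>y. ennreal \<bar>f y\<bar>) \<in> borel_measurable borel" by measurable
  have "(\<lambda>x. \<integral>\<^sup>+\<omega>. extend_zero (\<lambda>y. ennreal \<bar>f y\<bar>) (X (ennreal t) \<omega>) \<partial>P (Some x)) \<in> borel_measurable \<mu>"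
    using measurable_nn_trans[OF g_meas] by (simp add: measurable_cong_sets[OF sets refl])
  moreover have "(\<integral>\<^sup>+x. (\<integral>\<^sup>+\<omega>. extend_zero (\<lambda>y. ennreal \<bar>f y\<bar>) (X (ennreal t) \<omega>) \<partial>P (Some x)) \<partial>\<mu>) < \<infinity>"
    using nn_integral_trans_le[OF sym t g_meas] f unfolding integrable_iff_bounded real_norm_def
    by (blast intro: le_less_trans)
  ultimately have "AE x in \<mu>. (\<integral>\<^sup>+\<omega>. extend_zero (\<lambda>y. ennreal \<bar>f y\<bar>) (X (ennreal t) \<omega>) \<partial>P (Some x)) \<noteq> \<infinity>"
    by (intro nn_integral_PInf_AE) auto
  then show ?thesis
  proof eventually_elim
    fix x assume fin: "(\<integral>\<^sup>+\<omega>. extend_zero (\<lambda>y. ennreal \<bar>f y\<bar>) (X (ennreal t) \<omega>) \<partial>P (Some x)) \<noteq> \<infinity>"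
    have "ennreal (norm (extend_zero f z)) = extend_zero (\<lambda>y. ennreal \<bar>f y\<bar>) z" for z
      by (cases z) simp_all
    with fin show "integrable (P (Some x)) (\<lambda>\<omega>. extend_zero f (X (ennreal t) \<omega>))"
      by (intro integrableI_bounded measurable_compose[OF measurable_X_P borel_measurable_extend_zero[OF f_meas]])
        (simp add: less_top)
  qed
qed

lemma nn_trans_duality:
  fixes g :: "'a \<Rightarrow> ennreal"
  assumes sym: "symmetric_process \<mu> X P" and t: "0 < t" and g: "g \<in> borel_measurable borel" and A: "A \<in> sets borel"
  shows "(\<integral>\<^sup>+x. (\<integral>\<^sup>+\<omega>. extend_zero g (X (ennreal t) \<omega>) \<partial>P (Some x)) * indicator A x \<partial>\<mu>)
    = (\<integral>\<^sup>+x. g x * ennreal (trans_op X P t (indicator A) x) \<partial>\<mu>)"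
proof -
  have ind: "(\<integral>\<^sup>+\<omega>. extend_zero (indicator A) (X (ennreal t) \<omega>) \<partial>P (Some x)) = ennreal (trans_op X P t (indicator A) x)" for x
  proof -
    interpret prob_space "P (Some x)" by (rule prob_space_P)
    have "extend_zero (indicator A) z = (indicator (Some ` A) z :: ennreal)" for z
      by (cases z) (auto simp: indicator_def)
    then have "(\<integral>\<^sup>+\<omega>. extend_zero (indicator A) (X (ennreal t) \<omega>) \<partial>P (Some x))
        = (\<integral>\<^sup>+\<omega>. indicator {\<omega> \<in> space M. X (ennreal t) \<omega> \<in> Some ` A} \<omega> \<partial>P (Some x))"
      by (intro nn_integral_cong) (auto simp: indicator_def)
    then show ?thesis
      using sets_X_in[OF sets_borel_Some_image[OF A]]
      by (simp add: sets_P emeasure_eq_measure trans_op_indicator[OF A])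
  qed
  have "(\<integral>\<^sup>+x. indicator A x * (\<integral>\<^sup>+\<omega>. extend_zero g (X (ennreal t) \<omega>) \<partial>P (Some x)) \<partial>\<mu>)
      = (\<integral>\<^sup>+x. (\<integral>\<^sup>+\<omega>. extend_zero (indicator A) (X (ennreal t) \<omega>) \<partial>P (Some x)) * g x \<partial>\<mu>)"
    using t g A by (intro sym[unfolded symmetric_process_def, rule_format]) auto
  then show ?thesis by (simp add: ind mult.commute)
qed

text \<open>The symmetry of the process concerns nonnegative functions; splitting \<open>f\<close> into its positive and
  negative part extends it to the pairing of \<open>L\<^sup>1\<close> with indicator functions.\<close>

lemma trans_op_L1:
  fixes f :: "'a \<Rightarrow> real"
  assumes sym: "symmetric_process \<mu> X P" and sets: "sets \<mu> = sets borel" and t: "0 < t" and f: "integrable \<mu> f"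
  shows "integrable \<mu> (trans_op X P t f)"
    and "A \<in> sets \<mu> \<Longrightarrow> (LINT x|\<mu>. trans_op X P t f x * indicator A x) = (LINT x|\<mu>. f x * trans_op X P t (indicator A) x)"
proof -
  note borel_eq = measurable_cong_sets[OF sets refl]
  define N where "N g x = (\<integral>\<^sup>+\<omega>. extend_zero g (X (ennreal t) \<omega>) \<partial>P (Some x))" for g :: "'a \<Rightarrow> ennreal" and x
  define p where "p y = ennreal (f y)" for y
  define n where "n y = ennreal (- f y)" for y
  have [measurable]: "f \<in> borel_measurable borel"
    using borel_measurable_integrable[OF f] by (simp add: borel_eq)
  have [measurable]: "f \<in> borel_measurable \<mu>" using f by simp
  have pn_meas: "p \<in> borel_measurable borel" "n \<in> borel_measurable borel"
    unfolding p_def n_def by measurable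
  have N_meas [measurable]: "N p \<in> borel_measurable \<mu>" "N n \<in> borel_measurable \<mu>"
    using measurable_nn_trans[OF pn_meas(1)] measurable_nn_trans[OF pn_meas(2)] by (simp_all add: N_def[abs_def] borel_eq)
  have fin: "(\<integral>\<^sup>+x. p x \<partial>\<mu>) < \<infinity>" "(\<integral>\<^sup>+x. n x \<partial>\<mu>) < \<infinity>"
    using f by (auto simp: p_def n_def real_integrable_def less_top)
  have N_fin: "(\<integral>\<^sup>+x. N p x \<partial>\<mu>) < \<infinity>" "(\<integral>\<^sup>+x. N n x \<partial>\<mu>) < \<infinity>"
    using nn_integral_trans_le[OF sym t] pn_meas fin unfolding N_def by (blast intro: le_less_trans)+
  have AE_fin: "AE x in \<mu>. N p x \<noteq> \<infinity>" "AE x in \<mu>. N n x \<noteq> \<infinity>"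
    using nn_integral_PInf_AE[OF N_meas(1)] nn_integral_PInf_AE[OF N_meas(2)] N_fin by simp_all
  have split: "AE x in \<mu>. trans_op X P t f x = enn2real (N p x) - enn2real (N n x)"
    using AE_integrable_trans[OF sym sets t f]
  proof eventually_elim
    fix x assume "integrable (P (Some x)) (\<lambda>\<omega>. extend_zero f (X (ennreal t) \<omega>))"
    then have "trans_op X P t f x
        = enn2real (\<integral>\<^sup>+\<omega>. ennreal (extend_zero f (X (ennreal t) \<omega>)) \<partial>P (Some x))
        - enn2real (\<integral>\<^sup>+\<omega>. ennreal (- extend_zero f (X (ennreal t) \<omega>)) \<partial>P (Some x))"
      unfolding trans_op_def by (rule real_lebesgue_integral_def)
    moreover have "ennreal (- extend_zero f z) = extend_zero n z" "ennreal (extend_zero f z) = extend_zero p z" for z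
      by (cases z; simp add: n_def p_def)+
    ultimately show "trans_op X P t f x = enn2real (N p x) - enn2real (N n x)"
      by (simp add: N_def)
  qed
  have part: "integrable \<mu> (\<lambda>x. enn2real (N g x) * indicator A x)"
    "(LINT x|\<mu>. enn2real (N g x) * indicator A x) = enn2real (\<integral>\<^sup>+x. g x * ennreal (trans_op X P t (indicator A) x) \<partial>\<mu>)"
    if g: "g \<in> borel_measurable borel" "N g \<in> borel_measurable \<mu>" "(\<integral>\<^sup>+x. N g x \<partial>\<mu>) < \<infinity>" "AE x in \<mu>. N g x \<noteq> \<infinity>" and A: "A \<in> sets borel" for g A
  proof -
    have [measurable]: "N g \<in> borel_measurable \<mu>" "A \<in> sets \<mu>" using g A sets by auto
    have "(\<integral>\<^sup>+x. ennreal (enn2real (N g x) * indicator A x) \<partial>\<mu>) = (\<integral>\<^sup>+x. N g x * indicator A x \<partial>\<mu>)"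
      using g(4) by (intro nn_integral_cong_AE, eventually_elim) (auto simp: indicator_def less_top)
    also have eq: "\<dots> = (\<integral>\<^sup>+x. g x * ennreal (trans_op X P t (indicator A) x) \<partial>\<mu>)"
      unfolding N_def by (rule nn_trans_duality[OF sym t g(1) A])
    finally have nn: "(\<integral>\<^sup>+x. ennreal (enn2real (N g x) * indicator A x) \<partial>\<mu>) = (\<integral>\<^sup>+x. g x * ennreal (trans_op X P t (indicator A) x) \<partial>\<mu>)" .
    have "(\<integral>\<^sup>+x. N g x * indicator A x \<partial>\<mu>) \<le> (\<integral>\<^sup>+x. N g x \<partial>\<mu>)"
      by (intro nn_integral_mono) (auto simp: indicator_def)
    then have "(\<integral>\<^sup>+x. ennreal (enn2real (N g x) * indicator A x) \<partial>\<mu>) < \<infinity>"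
      using g(3) unfolding nn eq by (rule le_less_trans)
    then show "integrable \<mu> (\<lambda>x. enn2real (N g x) * indicator A x)"
      by (intro integrableI_nonneg) auto
    show "(LINT x|\<mu>. enn2real (N g x) * indicator A x) = enn2real (\<integral>\<^sup>+x. g x * ennreal (trans_op X P t (indicator A) x) \<partial>\<mu>)"
      unfolding nn[symmetric] by (intro integral_eq_nn_integral) auto
  qed
  note part_p = part[OF pn_meas(1) N_meas(1) N_fin(1) AE_fin(1)]
  note part_n = part[OF pn_meas(2) N_meas(2) N_fin(2) AE_fin(2)]
  have trans_meas [measurable]: "trans_op X P t f \<in> borel_measurable \<mu>"
    using measurable_trans_op[of f t] by (simp add: borel_eq)
  have "integrable \<mu> (\<lambda>x. enn2real (N p x) - enn2real (N n x))"
    using part_p(1)[of UNIV] part_n(1)[of UNIV] by simp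
  then show "integrable \<mu> (trans_op X P t f)"
    by (rule integrable_cong_AE_imp) (use split in \<open>auto elim: eventually_mono\<close>)
  assume "A \<in> sets \<mu>"
  then have A [measurable]: "A \<in> sets borel" and A' [measurable]: "A \<in> sets \<mu>" by (simp_all add: sets)
  define q where "q = trans_op X P t (indicator A)"
  have q [measurable]: "q \<in> borel_measurable \<mu>"
    unfolding q_def using measurable_trans_op_indicator[OF A] by (simp add: borel_eq)
  have q_bounds: "0 \<le> q x" "q x \<le> 1" for x
    unfolding q_def by (rule trans_op_indicator_bounds[OF A])+
  have fq: "integrable \<mu> (\<lambda>x. f x * q x)"
    by (rule Bochner_Integration.integrable_bound[OF f])
      (use q_bounds in \<open>auto simp: abs_mult intro!: mult_left_le\<close>)
  have "(LINT x|\<mu>. trans_op X P t f x * indicator A x)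
      = (LINT x|\<mu>. enn2real (N p x) * indicator A x - enn2real (N n x) * indicator A x)"
    using split by (intro integral_cong_AE) (auto elim!: eventually_mono simp: left_diff_distrib)
  also have "\<dots> = enn2real (\<integral>\<^sup>+x. p x * ennreal (q x) \<partial>\<mu>) - enn2real (\<integral>\<^sup>+x. n x * ennreal (q x) \<partial>\<mu>)"
    by (simp add: part_p[OF A] part_n[OF A] q_def)
  also have "\<dots> = (LINT x|\<mu>. f x * q x)"
  proof -
    have "ennreal (- (f x * q x)) = n x * ennreal (q x)" "ennreal (f x * q x) = p x * ennreal (q x)" for x
      using q_bounds(1) ennreal_mult''[of "q x" "f x"] ennreal_mult''[of "q x" "- f x"] by (simp_all add: p_def n_def)
    with real_lebesgue_integral_def[OF fq] show ?thesis by simp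
  qed
  finally show "(LINT x|\<mu>. trans_op X P t f x * indicator A x) = (LINT x|\<mu>. f x * trans_op X P t (indicator A) x)"
    by (simp add: q_def)
qed

end

section \<open>Compactness of the semigroup\<close>

text \<open>A convergent subsequence contains two members close to its limit.\<close>

lemma part_op_close_pair:
  assumes sets: "sets \<mu> = sets borel" and U: "U \<in> sets \<mu>" and d: "0 < d"
    and compact: "compact_operator Linf_norm (restrict_space \<mu> U) T"
    and h: "\<And>n::nat. h n \<in> borel_measurable borel" "\<And>n x. \<bar>h n x\<bar> \<le> 1"
  shows "\<exists>m n. m < n \<and> (AE x in \<mu>. x \<in> U \<longrightarrow> \<bar>T (h m) x - T (h n) x\<bar> \<le> 2 * d)"
proof -
  let ?R = "restrict_space \<mu> U"
  have h_meas: "h n \<in> borel_measurable ?R" for n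
    using h(1) by (intro measurable_restrict_space1) (simp add: measurable_cong_sets[OF sets refl])
  have h_norm: "Linf_norm ?R (h n) \<le> 1" for n
  proof -
    have "(\<lambda>x. ennreal \<bar>h n x\<bar>) \<in> borel_measurable ?R" using h_meas[of n] by measurable
    moreover have "ennreal \<bar>h n x\<bar> \<le> 1" for x using h(2)[of n x] by simp
    ultimately show ?thesis unfolding Linf_norm_def by (intro esssup_I) auto
  qed
  have h_space: "h n \<in> Lspace Linf_norm ?R" for n
    using h_meas h_norm[of n] by (auto simp: Lspace_def intro: le_less_trans)
  obtain g r where g: "g \<in> Lspace Linf_norm ?R" and r: "strict_mono r"
    and lim: "(\<lambda>n. Linf_norm ?R (\<lambda>x. T (h (r n)) x - g x)) \<longlonglongrightarrow> 0"
  proof -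
    have "\<exists>g\<in>Lspace Linf_norm ?R. \<exists>r. strict_mono r \<and>
        (\<lambda>n. Linf_norm ?R (\<lambda>x. T (h (r n)) x - g x)) \<longlonglongrightarrow> 0"
      using compact[unfolded compact_operator_def, THEN conjunct2, THEN conjunct2, rule_format, of h] h_space h_norm
      by simp
    then show thesis using that by (elim bexE exE conjE)
  qed
  have "\<forall>\<^sub>F n in sequentially. Linf_norm ?R (\<lambda>x. T (h (r n)) x - g x) < ennreal d"
    using lim d by (intro order_tendstoD(2)) auto
  then obtain N where N: "\<And>n. n \<ge> N \<Longrightarrow> Linf_norm ?R (\<lambda>x. T (h (r n)) x - g x) < ennreal d"
    unfolding eventually_sequentially by blast
  have near: "AE x in ?R. \<bar>T (h (r n)) x - g x\<bar> \<le> d" if "n \<ge> N" for n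
    using esssup_AE[of "\<lambda>x. ennreal \<bar>T (h (r n)) x - g x\<bar>" ?R]
  proof eventually_elim
    fix x assume "ennreal \<bar>T (h (r n)) x - g x\<bar> \<le> esssup ?R (\<lambda>x. ennreal \<bar>T (h (r n)) x - g x\<bar>)"
    also have "\<dots> < ennreal d" using N[OF that] by (simp add: Linf_norm_def)
    finally show "\<bar>T (h (r n)) x - g x\<bar> \<le> d" by (simp add: ennreal_less_iff)
  qed
  have "AE x in ?R. \<bar>T (h (r N)) x - T (h (r (Suc N))) x\<bar> \<le> 2 * d"
    using near[of N, OF order_refl] near[of "Suc N", OF le_SucI[OF order_refl]]
    by eventually_elim linarith
  moreover have "U \<inter> space \<mu> \<in> sets \<mu>" using U by simp
  ultimately have "AE x in \<mu>. x \<in> U \<longrightarrow> \<bar>T (h (r N)) x - T (h (r (Suc N))) x\<bar> \<le> 2 * d"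
    by (simp add: AE_restrict_space_iff)
  moreover have "r N < r (Suc N)" using r by (simp add: strict_mono_Suc_iff)
  ultimately show ?thesis by blast
qed

text \<open>The operator \<open>p\<^sub>2\<^sub>t\<close> is uniformly close to \<open>p\<^sub>t\<^sup>U p\<^sub>t\<close> on \<open>U\<close> and uniformly small outside of \<open>U\<close>,
  if \<open>U\<close> is a relatively compact neighbourhood of a compact set outside of which the process hardly
  survives for time \<open>t\<close>.  Compactness of \<open>p\<^sub>t\<^sup>U\<close> then provides close pairs in every sequence of
  indicator functions.\<close>

lemma finite_net_of_trans_op_indicators:
  fixes \<mu> :: "'a::metric_space measure"
  assumes hunt: "hunt_process M F X \<theta> P" and loc: "locally_compact_space (euclidean :: 'a topology)"
    and radon: "radon_measure \<mu>"
    and tight: "vanishes_at_cemetery (resolvent_op X P 1 (\<lambda>_. 1))"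
    and compact: "\<And>U. open U \<Longrightarrow> emeasure \<mu> U < \<infinity> \<Longrightarrow>
      compact_operator Linf_norm (restrict_space \<mu> U) (part_op X P U t)"
    and t: "0 < t" and e: "0 < e"
  shows "\<exists>T. finite T \<and> T \<subseteq> sets \<mu> \<and> (\<forall>A\<in>sets \<mu>. \<exists>B\<in>T.
    AE x in \<mu>. \<bar>trans_op X P (t + t) (indicator B) x - trans_op X P (t + t) (indicator A) x\<bar> \<le> e)"
proof -
  interpret hunt_process M F X \<theta> P by (rule hunt)
  have sets: "sets \<mu> = sets borel" using radon by (simp add: radon_measure_def)
  \<comment> \<open>The part operator leaves a close pair \<open>2 * d\<close> apart, and replacing it by the semigroup costs
    another \<open>d\<close> for each member.\<close>
  define d where "d = e / 4"
  have d: "0 < d" using e by (simp add: d_def)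
  define c where "c = t * exp (- t)"
  have c: "0 < c" using t by (simp add: c_def)
  obtain K where K: "compact K" "\<And>x. x \<notin> K \<Longrightarrow> \<bar>resolvent_op X P 1 (\<lambda>_. 1) x\<bar> < c * d"
    using tight c d unfolding vanishes_at_cemetery_def by (metis mult_pos_pos)
  have surv: "measure (P (Some x)) {\<omega> \<in> space M. X (ennreal t) \<omega> \<in> range Some} \<le> d" if "x \<notin> K" for x
  proof -
    have "c * measure (P (Some x)) {\<omega> \<in> space M. X (ennreal t) \<omega> \<in> range Some} \<le> c * d"
      using survival_le_resolvent[OF t, of x] K(2)[OF that] unfolding c_def by linarith
    with c show ?thesis by simp
  qed
  obtain U L where U: "open U" "compact L" "K \<subseteq> U" "U \<subseteq> L"
    using loc K(1) locally_compact_space_compact_closed_compact[of "euclidean :: 'a topology"]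
    by (auto simp: compactin_euclidean_iff)
  have L: "L \<in> sets \<mu>" using compact_imp_closed[OF U(2)] by (simp add: sets)
  have "emeasure \<mu> U \<le> emeasure \<mu> L" using U(4) L by (rule emeasure_mono)
  also have "\<dots> < \<infinity>" using radon U(2) by (simp add: radon_measure_def)
  finally have fin: "emeasure \<mu> U < \<infinity>" .
  obtain V C N where VC: "\<And>n. open (V n)" "\<And>n. compact (C n)" "\<And>n. V n \<subseteq> C n"
    "incseq V" "incseq C" "\<And>n. C n \<subseteq> U" "U = (\<Union>n. V n)" "K \<subseteq> V N"
    by (rule compact_exhaustion_of_open[OF U(1) U(4) U(2) K(1) U(3)]) (rule that)
  have near: "\<bar>trans_op X P (t + t) (indicator A) x - part_op X P U t (trans_op X P t (indicator A)) x\<bar> \<le> d"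
    if "x \<in> U" "A \<in> sets borel" for x A
    using trans_op_double_time_near_part_op[OF VC(1) VC(3,4) VC(2) compact_imp_closed[OF VC(2)] VC(5,6,7) that(1) t VC(8) surv less_imp_le[OF d] that(2)] .
  show ?thesis
  proof (rule finite_net_if_close_pairs)
    fix f :: "nat \<Rightarrow> 'a set" assume "range f \<subseteq> sets \<mu>"
    then have f: "f n \<in> sets borel" for n by (auto simp: sets)
    have "U \<in> sets \<mu>" using U(1) by (simp add: sets)
    then obtain m n where mn: "m < n" and close: "AE x in \<mu>. x \<in> U \<longrightarrow>
        \<bar>part_op X P U t (trans_op X P t (indicator (f m))) x - part_op X P U t (trans_op X P t (indicator (f n))) x\<bar> \<le> 2 * d"
      using part_op_close_pair[OF sets _ d compact[OF U(1) fin], of "\<lambda>n. trans_op X P t (indicator (f n))"]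
        measurable_trans_op_indicator[OF f] trans_op_indicator_bounds[OF f] by (auto simp: abs_of_nonneg)
    have "AE x in \<mu>. \<bar>trans_op X P (t + t) (indicator (f m)) x - trans_op X P (t + t) (indicator (f n)) x\<bar> \<le> e"
      using close
    proof eventually_elim
      fix x assume close: "x \<in> U \<longrightarrow>
        \<bar>part_op X P U t (trans_op X P t (indicator (f m))) x - part_op X P U t (trans_op X P t (indicator (f n))) x\<bar> \<le> 2 * d"
      show "\<bar>trans_op X P (t + t) (indicator (f m)) x - trans_op X P (t + t) (indicator (f n)) x\<bar> \<le> e"
      proof (cases "x \<in> U")
        case True
        with close near[OF True f, of m] near[OF True f, of n] show ?thesis unfolding d_def by linarith
      next
        case False
        then have "x \<notin> K" using U(3) by blast
        have "0 \<le> trans_op X P (t + t) (indicator (f k)) x \<and> trans_op X P (t + t) (indicator (f k)) x \<le> d" for k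
          using trans_op_indicator_bounds(1)[OF f] trans_op_indicator_le_survival[OF t f] surv[OF \<open>x \<notin> K\<close>]
          by (meson order_trans)
        from this[of m] this[of n] e show ?thesis unfolding d_def by linarith
      qed
    qed
    with mn show "\<exists>m n. m < n \<and>
        (AE x in \<mu>. \<bar>trans_op X P (t + t) (indicator (f m)) x - trans_op X P (t + t) (indicator (f n)) x\<bar> \<le> e)"
      by blast
  qed
qed

lemma Lspace_L1_iff: "f \<in> Lspace L1_norm M \<longleftrightarrow> integrable M f"
  by (simp add: Lspace_def L1_norm_def integrable_iff_bounded)

lemma L1_norm_eq_integral: "integrable M f \<Longrightarrow> L1_norm M f = ennreal (LINT x|M. \<bar>f x\<bar>)"
  unfolding L1_norm_def by (intro nn_integral_eq_integral) auto

theorem corollary2p3: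
  fixes \<mu> :: "'a::{metric_space, second_countable_topology} measure"
    and M :: "'w measure"
    and F :: "ennreal \<Rightarrow> 'w measure"
    and X :: "ennreal \<Rightarrow> 'w \<Rightarrow> 'a option"
    and \<theta> :: "ennreal \<Rightarrow> 'w \<Rightarrow> 'w"
    and P :: "'a option \<Rightarrow> 'w measure"
  assumes "locally_compact_space (euclidean :: 'a topology)"
    and "radon_measure \<mu>" and "full_support \<mu>"
    and "hunt_process M F X \<theta> P"
    and "symmetric_process \<mu> X P"
    and strong_feller: "\<And>(t::real) f. 0 < t \<Longrightarrow> f \<in> borel_measurable borel \<Longrightarrow> bounded (range f) \<Longrightarrow>
           continuous_on UNIV (trans_op X P t f) \<and> bounded (range (trans_op X P t f))"
    and tightness: "vanishes_at_cemetery (resolvent_op X P 1 (\<lambda>_. 1))"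
    and local_compactness: "\<And>(t::real) U. 0 < t \<Longrightarrow> open U \<Longrightarrow> emeasure \<mu> U < \<infinity> \<Longrightarrow>
           compact_operator Linf_norm (restrict_space \<mu> U) (part_op X P U t)"
  shows "\<forall>t::real. 0 < t \<longrightarrow> compact_operator L1_norm \<mu> (trans_op X P t)"
proof (intro allI impI)
  fix t :: real assume t: "0 < t"
  interpret hunt_process M F X \<theta> P by fact
  have sets: "sets \<mu> = sets borel" using \<open>radon_measure \<mu>\<close> by (simp add: radon_measure_def)
  have sym: "symmetric_process \<mu> X P" by fact
  show "compact_operator L1_norm \<mu> (trans_op X P t)"
    unfolding compact_operator_def
  proof (intro conjI ballI allI impI)
    fix f assume "f \<in> Lspace L1_norm \<mu>"
    then show "trans_op X P t f \<in> Lspace L1_norm \<mu>"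
      unfolding Lspace_L1_iff by (rule trans_op_L1(1)[OF sym sets t])
  next
    fix f g :: "'a \<Rightarrow> real" and a b :: real
    assume "f \<in> Lspace L1_norm \<mu>" "g \<in> Lspace L1_norm \<mu>"
    then have fg: "integrable \<mu> f" "integrable \<mu> g" by (simp_all add: Lspace_L1_iff)
    show "AE x in \<mu>. trans_op X P t (\<lambda>y. a * f y + b * g y) x = a * trans_op X P t f x + b * trans_op X P t g x"
      using AE_integrable_trans[OF sym sets t fg(1)] AE_integrable_trans[OF sym sets t fg(2)]
    proof eventually_elim
      fix x
      assume "integrable (P (Some x)) (\<lambda>\<omega>. extend_zero f (X (ennreal t) \<omega>))"
        "integrable (P (Some x)) (\<lambda>\<omega>. extend_zero g (X (ennreal t) \<omega>))"
      moreover have "extend_zero (\<lambda>y. a * f y + b * g y) z = a * extend_zero f z + b * extend_zero g z" for z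
        by (cases z) simp_all
      ultimately show "trans_op X P t (\<lambda>y. a * f y + b * g y) x = a * trans_op X P t f x + b * trans_op X P t g x"
        by (simp add: trans_op_def)
    qed
  next
    fix f :: "nat \<Rightarrow> 'a \<Rightarrow> real"
    assume f: "\<forall>n. f n \<in> Lspace L1_norm \<mu> \<and> L1_norm \<mu> (f n) \<le> 1"
    then have int_f: "integrable \<mu> (f n)" for n by (simp add: Lspace_L1_iff)
    have norm_f: "(LINT x|\<mu>. \<bar>f n x\<bar>) \<le> 1" for n
      using f L1_norm_eq_integral[OF int_f[of n]] by (metis ennreal_le_1)
    have int_u: "integrable \<mu> (trans_op X P t (f n))" for n
      by (rule trans_op_L1(1)[OF sym sets t int_f])
    obtain g r where g: "integrable \<mu> g" and r: "strict_mono r"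
      and lim: "(\<lambda>n. LINT x|\<mu>. \<bar>trans_op X P t (f (r n)) x - g x\<bar>) \<longlonglongrightarrow> 0"
    proof (rule L1_compact_if_dual_precompact[OF int_f norm_f int_u])
      fix n A assume "A \<in> sets \<mu>"
      then show "(LINT x|\<mu>. trans_op X P t (f n) x * indicator A x) = (LINT x|\<mu>. f n x * trans_op X P t (indicator A) x)"
        by (rule trans_op_L1(2)[OF sym sets t int_f])
    next
      fix A assume "A \<in> sets \<mu>"
      then have A: "A \<in> sets borel" by (simp add: sets)
      show "trans_op X P t (indicator A) \<in> borel_measurable \<mu>"
        using measurable_trans_op_indicator[OF A] by (simp add: measurable_cong_sets[OF sets refl])
      show "\<bar>trans_op X P t (indicator A) x\<bar> \<le> 1" for x
        using trans_op_indicator_bounds[OF A, of t x] by simp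
    next
      fix e :: real assume "0 < e"
      show "\<exists>T. finite T \<and> T \<subseteq> sets \<mu> \<and> (\<forall>A\<in>sets \<mu>. \<exists>B\<in>T.
          AE x in \<mu>. \<bar>trans_op X P t (indicator B) x - trans_op X P t (indicator A) x\<bar> \<le> e)"
        \<comment> \<open>The net is for \<open>p\<^sub>2\<^sub>s\<close> with \<open>s = t / 2\<close>.\<close>
        using finite_net_of_trans_op_indicators[OF assms(4,1,2) tightness local_compactness, of "t / 2" e] t \<open>0 < e\<close>
        by simp
    qed
    have "(\<lambda>n. L1_norm \<mu> (\<lambda>x. trans_op X P t (f (r n)) x - g x)) \<longlonglongrightarrow> ennreal 0"
      using tendsto_ennrealI[OF lim] int_u g by (simp add: L1_norm_eq_integral)
    with g r show "\<exists>g\<in>Lspace L1_norm \<mu>. \<exists>r. strict_mono r \<and>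
        (\<lambda>n. L1_norm \<mu> (\<lambda>x. trans_op X P t (f (r n)) x - g x)) \<longlonglongrightarrow> 0"
      by (auto simp: Lspace_L1_iff)
  qed
qed

end
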